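(* Suppose that $(\rho_n,n\ge1)$ is a sequence of measures on $\mathbb{R}^d$ converging weakly to $\rho$. Assume that $\rho_n$ is $\alpha_n$-super log-concave for any $n\ge1$. Then $\rho$ is $\alpha_0$-super log-concave, where $\alpha_0=\inf_n\alpha_n$.
   Context: Measure on $\mathbb{R}^d$ means positive Radon measure; weak convergence means convergence of integrals of bounded continuous functions. A function $\theta:\mathbb{R}^d\to[0,\infty)$ is log-concave if $\theta(sx+ty)\ge\theta(x)^s\theta(y)^t$ for all $x,y$ and $s,t\ge0$, $s+t=1$ (zero values are allowed). A measure $\nu$ on $\mathbb{R}^d$ is log-concave if for every log-concave continuous function $\theta$ of compact support the convolution $\theta\star\nu$ has a log-concave density with respect to Lebesgue measure. A measure $\rho$ is $\alpha$-super log-concave ($\alpha\ge0$) if $e^{\frac{\alpha}{2}|x|^2}\rho(dx)$ is log-concave, $|\cdot|$ being the Euclidean norm. *)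

theory Defs
  imports "HOL-Probability.Probability"
begin

definition radon_measure :: "'a::euclidean_space measure \<Rightarrow> bool" where
  "radon_measure \<mu> \<longleftrightarrow>
     sets \<mu> = sets borel \<and>
     (\<forall>K. compact K \<longrightarrow> emeasure \<mu> K < \<infinity>) \<and>
     (\<forall>B\<in>sets borel. emeasure \<mu> B = (SUP K\<in>{K. K \<subseteq> B \<and> compact K}. emeasure \<mu> K))"

text \<open>
  Radon measures may have infinite total mass, in which case the integral of a bounded continuous
  function of variable sign need not exist.  Hence nonnegative test functions are used, with
  integrals in \<open>[0, \<infinity>]\<close>.  For finite measures this is the usual notion; see
  \<open>weakly_converges_finite_iff\<close> below.
\<close>
definition weakly_converges :: "(nat \<Rightarrow> 'a::euclidean_space measure) \<Rightarrow> 'a measure \<Rightarrow> bool" where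
  "weakly_converges \<mu> \<nu> \<longleftrightarrow>
     (\<forall>f :: 'a \<Rightarrow> real. continuous_on UNIV f \<and> bounded (range f) \<and> (\<forall>x. 0 \<le> f x) \<longrightarrow>
        (\<lambda>n. \<integral>\<^sup>+x. ennreal (f x) \<partial>\<mu> n) \<longlonglongrightarrow> (\<integral>\<^sup>+x. ennreal (f x) \<partial>\<nu>))"

text \<open>
  Note that \<open>0 powr 0 = 0\<close>.  With the convention \<open>0\<^sup>0 = 1\<close> the definition would be the same: when
  \<open>s = 0\<close> or \<open>t = 0\<close> the inequality holds trivially under both conventions.
\<close>
definition log_concave_fun :: "('a::euclidean_space \<Rightarrow> real) \<Rightarrow> bool" where
  "log_concave_fun \<theta> \<longleftrightarrow>
     (\<forall>x. 0 \<le> \<theta> x) \<and>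
     (\<forall>x y s t. 0 \<le> s \<and> 0 \<le> t \<and> s + t = 1 \<longrightarrow>
        \<theta> (s *\<^sub>R x + t *\<^sub>R y) \<ge> \<theta> x powr s * \<theta> y powr t)"

text \<open>
  The convolution of a function \<open>\<theta>\<close> with a measure \<open>\<nu>\<close> is the convolution of the measure
  \<open>\<theta>(x) dx\<close> with \<open>\<nu>\<close>.  Measurability of the density \<open>h\<close> has to be required, since a log-concave
  function can fail to be Borel on the boundary of its support.
\<close>
definition log_concave_measure :: "'a::ordered_euclidean_space measure \<Rightarrow> bool" where
  "log_concave_measure \<nu> \<longleftrightarrow>
     (\<forall>\<theta>. log_concave_fun \<theta> \<and> continuous_on UNIV \<theta> \<and> compact (closure {x. \<theta> x \<noteq> 0}) \<longrightarrow>
        (\<exists>h. h \<in> borel_measurable borel \<and> log_concave_fun h \<and>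
             (density lborel (\<lambda>x. ennreal (\<theta> x)) \<star> \<nu>) = density lborel (\<lambda>x. ennreal (h x))))"

definition super_log_concave :: "real \<Rightarrow> 'a::ordered_euclidean_space measure \<Rightarrow> bool" where
  "super_log_concave \<alpha> \<rho> \<longleftrightarrow>
     log_concave_measure (density \<rho> (\<lambda>x. ennreal (exp (\<alpha> / 2 * (norm x)\<^sup>2))))"

lemma weakly_converges_finite_iff:
  fixes \<mu> :: "nat \<Rightarrow> 'a::euclidean_space measure"
  assumes fin: "\<And>n. finite_measure (\<mu> n)" "finite_measure \<nu>"
    and sets: "\<And>n. sets (\<mu> n) = sets borel" "sets \<nu> = sets borel"
  shows "weakly_converges \<mu> \<nu> \<longleftrightarrow>
     (\<forall>f :: 'a \<Rightarrow> real. continuous_on UNIV f \<and> bounded (range f) \<longrightarrow>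
        (\<lambda>n. \<integral>x. f x \<partial>\<mu> n) \<longlonglongrightarrow> (\<integral>x. f x \<partial>\<nu>))" (is "_ \<longleftrightarrow> ?R")
proof -
  have int: "integrable M f"
    if asm: "finite_measure M" "sets M = sets borel" "continuous_on UNIV f" "bounded (range f)"
    for M and f :: "'a \<Rightarrow> real"
  proof -
    interpret finite_measure M by fact
    obtain B where B: "\<And>x. norm (f x) \<le> B"
      using asm(4) by (auto simp: bounded_iff)
    have "f \<in> borel_measurable M"
      using borel_measurable_continuous_onI[OF asm(3)] asm(2) measurable_cong_sets by blast
    then show ?thesis by (intro integrable_const_bound[where B=B] AE_I2 B)
  qed
  have eq: "(\<lambda>n. \<integral>\<^sup>+x. ennreal (f x) \<partial>\<mu> n) \<longlonglongrightarrow> (\<integral>\<^sup>+x. ennreal (f x) \<partial>\<nu>) \<longleftrightarrow>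
      (\<lambda>n. \<integral>x. f x \<partial>\<mu> n) \<longlonglongrightarrow> (\<integral>x. f x \<partial>\<nu>)"
    if "continuous_on UNIV f" "bounded (range f)" "\<And>x. 0 \<le> f x" for f :: "'a \<Rightarrow> real"
    using that int[OF fin(1) sets(1)] int[OF fin(2) sets(2)]
    by (simp add: nn_integral_eq_integral tendsto_ennreal_iff)
  show ?thesis
  proof
    assume W: "weakly_converges \<mu> \<nu>"
    show ?R
    proof (intro allI impI, elim conjE)
      fix f :: "'a \<Rightarrow> real" assume f: "continuous_on UNIV f" "bounded (range f)"
      obtain B where B: "\<And>x. norm (f x) \<le> B"
        using f(2) by (auto simp: bounded_iff)
      have B0: "0 \<le> B" using B[of undefined] norm_ge_zero order_trans by blast
      let ?g = "\<lambda>x. f x + B"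
      have g: "continuous_on UNIV ?g" "bounded (range ?g)"
        using f by (auto intro!: continuous_intros bounded_plus_comp)
      have g0: "0 \<le> ?g x" for x using B[of x] by (simp add: abs_le_iff)
      have c: "continuous_on UNIV (\<lambda>x::'a. B)" "bounded (range (\<lambda>x::'a. B))" by auto
      have "(\<lambda>n. \<integral>x. ?g x \<partial>\<mu> n) \<longlonglongrightarrow> (\<integral>x. ?g x \<partial>\<nu>)"
        using W g g0 eq[OF g g0] unfolding weakly_converges_def by blast
      moreover have "(\<lambda>n. \<integral>x. B \<partial>\<mu> n) \<longlonglongrightarrow> (\<integral>x. B \<partial>\<nu>)"
        using W c B0 eq[OF c B0] unfolding weakly_converges_def by blast
      ultimately have "(\<lambda>n. (\<integral>x. ?g x \<partial>\<mu> n) - (\<integral>x. B \<partial>\<mu> n)) \<longlonglongrightarrow> (\<integral>x. ?g x \<partial>\<nu>) - (\<integral>x. B \<partial>\<nu>)"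
        by (rule tendsto_diff)
      moreover have "(\<integral>x. ?g x \<partial>M) - (\<integral>x. B \<partial>M) = (\<integral>x. f x \<partial>M)"
        if "finite_measure M" "sets M = sets borel" for M
        using int[OF that f] int[OF that c] by (subst Bochner_Integration.integral_add) auto
      ultimately show "(\<lambda>n. \<integral>x. f x \<partial>\<mu> n) \<longlonglongrightarrow> (\<integral>x. f x \<partial>\<nu>)"
        using fin sets by simp
    qed
  next
    assume ?R
    then show "weakly_converges \<mu> \<nu>"
      unfolding weakly_converges_def using eq by blast
  qed
qed

end

theory Submission
  imports Defs
begin

text \<open>
  For a locally finite measure \<open>\<nu>\<close> and a test function \<open>\<theta>\<close> (log-concave, continuous, compactly
  supported), the measure \<open>\<theta> \<star> \<nu>\<close> has the continuous density \<open>x \<mapsto> \<integral>\<theta>(x - y) \<nu>(dy)\<close>.  A continuous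
  function that agrees almost everywhere with a log-concave one is itself log-concave, because a
  common small translation moves any three points into the set of agreement.  Hence \<open>\<nu>\<close> is
  log-concave exactly when all these continuous densities are
  (\<open>log_concave_measure_iff_convolve\<close>), and no choice of a version is left in the definition.

  Write \<open>\<alpha>\<^sub>0\<close> for the infimum of the \<open>\<alpha>\<^sub>n\<close>.  Given this criterion, the passage to the limit is
  elementary: for fixed \<open>x\<close> the integrand \<open>y \<mapsto> \<theta>(x - y) exp(\<alpha>\<^sub>0|y|\<^sup>2/2)\<close> is bounded and continuous,
  so the densities belonging to \<open>\<rho>\<^sub>n\<close> converge at every \<open>x\<close> to the density belonging to \<open>\<rho>\<close>, and
  pointwise limits of log-concave functions are log-concave.  It remains to see that every \<open>\<rho>\<^sub>n\<close>
  is \<open>\<alpha>\<^sub>0\<close>-super log-concave.  Since \<open>\<alpha>\<^sub>0 \<le> \<alpha>\<^sub>n\<close>, this amounts to multiplying a log-concave measure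
  by the Gaussian \<open>exp(-(\<alpha>\<^sub>n - \<alpha>\<^sub>0)|x|\<^sup>2/2)\<close>.

  That a continuous log-concave weight \<open>g\<close> preserves log-concavity of a measure
  (\<open>log_concave_measure_density\<close>) is the core of the proof.  Convolving \<open>\<nu>\<close> with tent functions of
  shrinking support gives log-concave functions \<open>H\<^sub>n\<close>.  The functions
  \<open>x \<mapsto> \<integral>\<theta>(x - y) g(y) H\<^sub>n(y) dy\<close> are marginals of log-concave functions, so the
  Prekopa-Leindler inequality (\<open>prekopa_leindler\<close>) applies to them, and after rescaling they tend
  to \<open>\<integral>\<theta>(x - y) g(y) \<nu>(dy)\<close> (\<open>tendsto_mollified_nn_integral\<close>).

  All inequalities are carried in their midpoint form \<open>f(x) g(y) \<le> h((x + y)/2)\<^sup>2\<close>.  It involves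
  only products, hence makes sense with values in \<open>[0, \<infinity>]\<close> and is stable under integration without
  any finiteness condition.  For continuous functions it is equivalent to log-concavity
  (\<open>log_concave_fun_of_midpoint\<close>).
\<close>

section \<open>The Brunn-Minkowski inequality on the line\<close>

lemma emeasure_lborel_inner_compact:
  fixes A :: "'a::euclidean_space set"
  assumes A: "A \<in> sets borel"
  shows "emeasure lborel A = (SUP K\<in>{K. compact K \<and> K \<subseteq> A}. emeasure lborel K)" (is "_ = ?S")
proof (rule antisym)
  show "?S \<le> emeasure lborel A"
    using A by (intro SUP_least) (auto intro!: emeasure_mono)
  have [measurable]: "A \<in> sets borel" by fact
  have bd: "emeasure lborel (A \<inter> cball 0 (real n)) \<le> ?S" for n
  proof (rule ennreal_le_epsilon)
    fix e :: real assume e: "0 < e"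
    have "A \<inter> cball 0 (real n) \<in> sets lebesgue" using A by simp
    then obtain T where T: "closed T" "T \<subseteq> A \<inter> cball 0 (real n)"
      "emeasure lebesgue ((A \<inter> cball 0 (real n)) - T) < ennreal e"
      using e by (rule sets_lebesgue_inner_closed)
    have cT: "compact T"
      using T by (auto simp: compact_eq_bounded_closed intro: bounded_subset[of "cball 0 (real n)"])
    have [measurable]: "T \<in> sets borel" using T(1) by (rule borel_closed)
    have "emeasure lborel (A \<inter> cball 0 (real n)) = emeasure lborel (T \<union> ((A \<inter> cball 0 (real n)) - T))"
      using T(2) by (intro arg_cong2[where f=emeasure]) auto
    also have "\<dots> \<le> emeasure lborel T + emeasure lborel ((A \<inter> cball 0 (real n)) - T)"
      by (intro emeasure_subadditive) auto
    also have "\<dots> \<le> ?S + ennreal e"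
      using T cT by (intro add_mono SUP_upper) (auto simp: less_imp_le)
    finally show "emeasure lborel (A \<inter> cball 0 (real n)) \<le> ?S + ennreal e" .
  qed
  have "(\<Union>n. A \<inter> cball 0 (real n)) = A"
    by (auto simp: real_arch_simple)
  moreover have "incseq (\<lambda>n. A \<inter> cball 0 (real n))" by (auto simp: incseq_def)
  ultimately have "emeasure lborel A = (SUP n. emeasure lborel (A \<inter> cball 0 (real n)))"
    using SUP_emeasure_incseq[of "\<lambda>n. A \<inter> cball 0 (real n)" lborel] A
    by (simp add: image_subset_iff del: Int_UN_distrib UN_simps)
  also have "\<dots> \<le> ?S" by (intro SUP_least bd)
  finally show "emeasure lborel A \<le> ?S" .
qed

lemma emeasure_lborel_half_translate:
  fixes c :: real
  assumes [measurable]: "C \<in> sets borel"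
  shows "emeasure lborel {x. (x + c) / 2 \<in> C} = 2 * emeasure lborel C"
proof -
  have [measurable]: "{x. (x + c) / 2 \<in> C} \<in> sets borel"
    by (rule pred_Collect_borel) measurable
  have "emeasure lborel {x. (x + c) / 2 \<in> C} = (\<integral>\<^sup>+x. indicator {x. (x + c) / 2 \<in> C} x \<partial>lborel)"
    by simp
  also have "\<dots> = ennreal \<bar>2\<bar> * (\<integral>\<^sup>+x. indicator {x. (x + c) / 2 \<in> C} (- c + 2 * x) \<partial>lborel)"
    by (rule nn_integral_real_affine) auto
  also have "(\<lambda>x. indicator {x. (x + c) / 2 \<in> C} (- c + 2 * x) :: ennreal) = indicator C"
    by (auto simp: indicator_def)
  finally show ?thesis by simp
qed

text \<open>
  For compact \<open>K\<close> and \<open>L\<close> with \<open>k = max K\<close> and \<open>l = min L\<close>, the sets \<open>(K + l)/2\<close> and \<open>(k + L)/2\<close> meet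
  only in the point \<open>(k + l)/2\<close> and both lie in \<open>C\<close>, so that their measures add up.  Inner regularity
  extends this to Borel sets.
\<close>
lemma brunn_minkowski_real:
  fixes A B C :: "real set"
  assumes A: "A \<in> sets borel" "A \<noteq> {}" and B: "B \<in> sets borel" "B \<noteq> {}"
    and C[measurable]: "C \<in> sets borel"
    and mid: "\<And>a b. a \<in> A \<Longrightarrow> b \<in> B \<Longrightarrow> (a + b) / 2 \<in> C"
  shows "emeasure lborel A + emeasure lborel B \<le> 2 * emeasure lborel C"
proof -
  obtain a0 b0 where ab0: "a0 \<in> A" "b0 \<in> B" using A B by blast
  have main: "emeasure lborel K + emeasure lborel L \<le> 2 * emeasure lborel C"
    if KL: "compact K" "K \<subseteq> A" "K \<noteq> {}" "compact L" "L \<subseteq> B" "L \<noteq> {}" for K L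
  proof -
    obtain k where k: "k \<in> K" "\<And>x. x \<in> K \<Longrightarrow> x \<le> k"
      using compact_attains_sup[OF KL(1,3)] by blast
    obtain l where l: "l \<in> L" "\<And>x. x \<in> L \<Longrightarrow> l \<le> x"
      using compact_attains_inf[OF KL(4,6)] by blast
    define m where "m = (k + l) / 2"
    have [measurable]: "K \<in> sets borel" "L \<in> sets borel"
      using KL by (auto intro: borel_compact)
    \<comment> \<open>Dropping the null set \<open>{k}\<close> makes the two pieces of \<open>C\<close>, left and right of \<open>m\<close>, disjoint.\<close>
    have "emeasure lborel K = emeasure lborel (K - {k})"
      by (subst emeasure_Diff_null_set) (auto simp: null_sets_def)
    also have "\<dots> \<le> emeasure lborel {x. (x + l) / 2 \<in> C \<inter> {..<m}}"
    proof (rule emeasure_mono)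
      show "K - {k} \<subseteq> {x. (x + l) / 2 \<in> C \<inter> {..<m}}"
        using k l KL mid by (fastforce simp: m_def order_less_le)
      show "{x. (x + l) / 2 \<in> C \<inter> {..<m}} \<in> sets lborel"
        unfolding sets_lborel by (rule pred_Collect_borel) measurable
    qed
    also have "\<dots> = 2 * emeasure lborel (C \<inter> {..<m})"
      by (rule emeasure_lborel_half_translate) auto
    finally have 1: "emeasure lborel K \<le> 2 * emeasure lborel (C \<inter> {..<m})" .
    have "emeasure lborel L \<le> emeasure lborel {x. (x + k) / 2 \<in> C \<inter> {m..}}"
    proof (rule emeasure_mono)
      show "L \<subseteq> {x. (x + k) / 2 \<in> C \<inter> {m..}}"
        using k l KL mid[of k] by (auto simp: m_def add.commute subset_iff)
      show "{x. (x + k) / 2 \<in> C \<inter> {m..}} \<in> sets lborel"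
        unfolding sets_lborel by (rule pred_Collect_borel) measurable
    qed
    also have "\<dots> = 2 * emeasure lborel (C \<inter> {m..})"
      by (rule emeasure_lborel_half_translate) auto
    finally have "emeasure lborel K + emeasure lborel L \<le>
        2 * (emeasure lborel (C \<inter> {..<m}) + emeasure lborel (C \<inter> {m..}))"
      using 1 by (auto simp: distrib_left intro: add_mono)
    also have "emeasure lborel (C \<inter> {..<m}) + emeasure lborel (C \<inter> {m..}) =
        emeasure lborel ((C \<inter> {..<m}) \<union> (C \<inter> {m..}))"
      by (rule plus_emeasure) auto
    also have "(C \<inter> {..<m}) \<union> (C \<inter> {m..}) = C" by auto
    finally show ?thesis .
  qed
  have main': "emeasure lborel K + emeasure lborel L \<le> 2 * emeasure lborel C"
    if KL: "compact K" "K \<subseteq> A" "compact L" "L \<subseteq> B" for K L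
  proof -
    have "emeasure lborel K + emeasure lborel L \<le>
        emeasure lborel (insert a0 K) + emeasure lborel (insert b0 L)"
      using KL by (intro add_mono emeasure_mono)
        (auto intro: borel_compact simp: borel_compact compact_insert)
    also have "\<dots> \<le> 2 * emeasure lborel C"
      using KL ab0 by (intro main) auto
    finally show ?thesis .
  qed
  let ?K = "{K. compact K \<and> K \<subseteq> A}" and ?L = "{L. compact L \<and> L \<subseteq> B}"
  have ne: "?K \<noteq> {}" "?L \<noteq> {}" by auto
  have KB: "emeasure lborel K + emeasure lborel B \<le> 2 * emeasure lborel C" if "K \<in> ?K" for K
  proof -
    have "emeasure lborel K + emeasure lborel B = (SUP L\<in>?L. emeasure lborel K + emeasure lborel L)"
      by (simp only: emeasure_lborel_inner_compact[OF B(1)] ennreal_SUP_add_right[OF ne(2)])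
    also have "\<dots> \<le> 2 * emeasure lborel C"
      using that by (intro SUP_least main') auto
    finally show ?thesis .
  qed
  have "emeasure lborel A + emeasure lborel B = (SUP K\<in>?K. emeasure lborel K + emeasure lborel B)"
    by (simp only: emeasure_lborel_inner_compact[OF A(1)] ennreal_SUP_add_left[OF ne(1)])
  also have "\<dots> \<le> 2 * emeasure lborel C"
    by (intro SUP_least KB)
  finally show ?thesis .
qed

section \<open>The Prekopa-Leindler inequality\<close>

text \<open>
  The arithmetic-geometric mean inequality, which turns the additive bound from the Brunn-Minkowski
  inequality into the multiplicative one of the Prekopa-Leindler inequality.
\<close>
lemma ennreal_mult_le_square_of_mean:
  fixes a b c :: ennreal
  assumes "a + b \<le> 2 * c"
  shows "a * b \<le> c\<^sup>2"
proof (cases "c = \<top>")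
  case True
  then show ?thesis by (simp add: ennreal_top_mult power2_eq_square)
next
  case False
  then obtain r where r: "c = ennreal r" "0 \<le> r" by (cases c) auto
  have "2 * c < \<top>" using r by (simp add: ennreal_mult_less_top)
  then have "a + b < \<top>" by (rule le_less_trans[OF assms])
  then obtain p q where pq: "a = ennreal p" "0 \<le> p" "b = ennreal q" "0 \<le> q"
    by (cases a; cases b) (auto simp: less_top)
  have "ennreal (p + q) \<le> ennreal (2 * r)"
    using assms pq r by (simp add: ennreal_plus ennreal_mult)
  then have "p + q \<le> 2 * r" using r by (simp only: ennreal_le_iff) 
  then have "(p + q)\<^sup>2 \<le> (2 * r)\<^sup>2"
    using pq r by (intro power_mono) auto
  moreover have "0 \<le> (p - q)\<^sup>2" by simp
  ultimately have "p * q \<le> r\<^sup>2" by (simp add: power2_eq_square algebra_simps)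
  then show ?thesis using pq r by (simp add: ennreal_leI ennreal_power flip: ennreal_mult)
qed

text \<open>
  Levels are measured relative to an upper bound \<open>a\<close>, so that they run over \<open>(0, 1)\<close> for every
  function.  Functions with different suprema can then be compared level by level.
\<close>
lemma nn_integral_layer_cake:
  fixes f :: "real \<Rightarrow> ennreal"
  assumes [measurable]: "f \<in> borel_measurable borel" and a: "0 < a" and le: "\<And>x. f x \<le> ennreal a"
  shows "(\<integral>\<^sup>+x. f x \<partial>lborel) =
    ennreal a * (\<integral>\<^sup>+l. emeasure lborel {x. ennreal (a * l) < f x} * indicator {0<..<1} l \<partial>lborel)"
proof -
  have pt: "f x = ennreal a * (\<integral>\<^sup>+l. indicator {x. ennreal (a * l) < f x} x * indicator {0<..<1} l \<partial>lborel)" for x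
  proof -
    obtain r where r: "f x = ennreal r" "0 \<le> r"
      using le[of x] by (cases "f x") (auto simp: top_unique)
    then have ra: "r \<le> a" using le[of x] a by auto
    have l1: "l < 1" if "l * a < r" for l
      using less_le_trans[OF that ra] a by simp
    have "(\<integral>\<^sup>+l. indicator {x. ennreal (a * l) < f x} x * indicator {0<..<1} l \<partial>lborel) =
        (\<integral>\<^sup>+l. indicator {0<..<r/a} l \<partial>lborel)"
      using r a ra by (intro nn_integral_cong)
        (auto simp: indicator_def ennreal_less_iff field_simps dest: l1)
    also have "\<dots> = ennreal (r / a)"
      using r a by simp
    finally show ?thesis
      using r a by (simp flip: ennreal_mult)
  qed
  have "(\<integral>\<^sup>+x. f x \<partial>lborel) =
      (\<integral>\<^sup>+x. ennreal a * (\<integral>\<^sup>+l. indicator {x. ennreal (a * l) < f x} x * indicator {0<..<1} l \<partial>lborel) \<partial>lborel)"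
    by (intro nn_integral_cong pt)
  also have "\<dots> = ennreal a *
      (\<integral>\<^sup>+x. (\<integral>\<^sup>+l. indicator {x. ennreal (a * l) < f x} x * indicator {0<..<1} l \<partial>lborel) \<partial>lborel)"
    by (intro nn_integral_cmult) (simp add: indicator_def)
  also have "(\<integral>\<^sup>+x. (\<integral>\<^sup>+l. indicator {x. ennreal (a * l) < f x} x * indicator {0<..<1} l \<partial>lborel) \<partial>lborel) =
      (\<integral>\<^sup>+l. (\<integral>\<^sup>+x. indicator {x. ennreal (a * l) < f x} x * indicator {0<..<1} l \<partial>lborel) \<partial>lborel)"
    by (rule lborel_pair.Fubini') (simp add: indicator_def case_prod_beta) 
  also have "\<dots> = (\<integral>\<^sup>+l. emeasure lborel {x. ennreal (a * l) < f x} * indicator {0<..<1} l \<partial>lborel)"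
    by (intro nn_integral_cong) (simp add: nn_integral_multc)
  finally show ?thesis .
qed

text \<open>
  Let \<open>a\<close> and \<open>b\<close> be the suprema of \<open>f\<close> and \<open>g\<close>, and \<open>c = sqrt (a b)\<close>.  For \<open>0 < l < 1\<close> the sets
  \<open>{f > a l}\<close> and \<open>{g > b l}\<close> are nonempty, and midpoints between them lie in \<open>{h > c l}\<close>.
  The Brunn-Minkowski inequality for these sets, integrated over \<open>l\<close>, bounds the mean of
  \<open>\<integral>f / a\<close> and \<open>\<integral>g / b\<close> by \<open>\<integral>h / c\<close>.  Normalising by the suprema is what guarantees that both level
  sets become empty at the same \<open>l\<close>.
\<close>
lemma prekopa_leindler_real_bounded:
  fixes f g h :: "real \<Rightarrow> ennreal"
  assumes meas[measurable]: "f \<in> borel_measurable borel" "g \<in> borel_measurable borel" "h \<in> borel_measurable borel"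
    and mid: "\<And>x y. f x * g y \<le> (h ((x + y) / 2))\<^sup>2"
    and bdd: "\<And>x. f x \<le> ennreal M" "\<And>x. g x \<le> ennreal M"
  shows "(\<integral>\<^sup>+x. f x \<partial>lborel) * (\<integral>\<^sup>+x. g x \<partial>lborel) \<le> (\<integral>\<^sup>+x. h x \<partial>lborel)\<^sup>2"
proof -
  have "(SUP x. f x) \<le> ennreal M" "(SUP x. g x) \<le> ennreal M"
    by (auto intro!: SUP_least bdd)
  then obtain a b where a: "(SUP x. f x) = ennreal a" "0 \<le> a" and b: "(SUP x. g x) = ennreal b" "0 \<le> b"
    by (cases "SUP x. f x"; cases "SUP x. g x") (auto simp: top_unique)
  have fa: "f x \<le> ennreal a" and gb: "g x \<le> ennreal b" for x
    unfolding a(1)[symmetric] b(1)[symmetric] by (auto intro: SUP_upper)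
  consider "a = 0" | "b = 0" | "0 < a" "0 < b" using a b by linarith
  then show ?thesis
  proof cases
    case 1
    then have "f = (\<lambda>_. 0)" using fa by auto
    then show ?thesis by simp
  next
    case 2
    then have "g = (\<lambda>_. 0)" using gb by auto
    then show ?thesis by simp
  next
    case 3
    define c where "c = sqrt (a * b)"
    have c: "0 < c" "c\<^sup>2 = a * b" using 3 by (auto simp: c_def)
    let ?F = "\<lambda>u t. (\<integral>\<^sup>+l. emeasure lborel {x. ennreal (t * l) < u x} * indicator {0<..<1} l \<partial>lborel)"
    have lev: "emeasure lborel {x. ennreal (a * l) < f x} + emeasure lborel {x. ennreal (b * l) < g x}
        \<le> 2 * emeasure lborel {x. ennreal (c * l) < h x}" if l: "0 < l" "l < 1" for l
    proof (rule brunn_minkowski_real)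
      have "ennreal (a * l) < (SUP x. f x)" "ennreal (b * l) < (SUP x. g x)"
        unfolding a(1) b(1) using l 3 by (auto simp: ennreal_less_iff)
      then show "{x. ennreal (a * l) < f x} \<noteq> {}" "{x. ennreal (b * l) < g x} \<noteq> {}"
        by (auto simp: less_SUP_iff)
      fix x y assume "x \<in> {x. ennreal (a * l) < f x}" "y \<in> {x. ennreal (b * l) < g x}"
      moreover obtain p q where pq: "f x = ennreal p" "0 \<le> p" "g y = ennreal q" "0 \<le> q"
        using fa[of x] gb[of y] by (cases "f x"; cases "g y") (auto simp: top_unique)
      ultimately have p: "a * l < p" and q: "b * l < q"
        using 3 l by (auto simp: ennreal_less_iff)
      then have "(a * l) * (b * l) < p * q"
        using 3 l by (intro mult_strict_mono) (auto intro: less_trans[of 0 "a * l"])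
      then have cl: "(c * l)\<^sup>2 < p * q"
        unfolding power_mult_distrib c(2) by (simp add: power2_eq_square ac_simps)
      show "(x + y) / 2 \<in> {x. ennreal (c * l) < h x}"
      proof (cases "h ((x + y) / 2)")
        case (real r)
        have "ennreal (p * q) \<le> ennreal (r\<^sup>2)"
          using mid[of x y] pq real by (simp add: ennreal_mult ennreal_power)
        then have "(c * l)\<^sup>2 < r\<^sup>2" using cl by (simp add: real)
        then have "c * l < r" using real by (simp add: power2_less_imp_less)
        then show ?thesis using real c l by (simp add: ennreal_less_iff)
      qed simp
    qed measurable
    have "?F f a + ?F g b =
        (\<integral>\<^sup>+l. (emeasure lborel {x. ennreal (a * l) < f x} + emeasure lborel {x. ennreal (b * l) < g x})
          * indicator {0<..<1} l \<partial>lborel)"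
      by (subst nn_integral_add[symmetric]) (auto simp: distrib_right)
    also have "\<dots> \<le> (\<integral>\<^sup>+l. 2 * (emeasure lborel {x. ennreal (c * l) < h x} * indicator {0<..<1} l) \<partial>lborel)"
      using lev by (intro nn_integral_mono) (auto simp: indicator_def)
    also have "\<dots> = 2 * ?F h c"
      by (subst nn_integral_cmult) auto
    finally have FGH: "?F f a * ?F g b \<le> (?F h c)\<^sup>2"
      by (rule ennreal_mult_le_square_of_mean)
    \<comment> \<open>\<open>h\<close> need not be bounded by \<open>c\<close>, but truncating it there changes no level set below \<open>c\<close>.\<close>
    have "ennreal c * ?F h c = ennreal c * ?F (\<lambda>x. min (h x) (ennreal c)) c"
    proof -
      have "ennreal (c * l) < ennreal c" if "l < 1" for l
        using c that by (intro ennreal_lessI) auto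
      then show ?thesis
        by (intro arg_cong[where f="(*) (ennreal c)"] nn_integral_cong) (auto split: split_indicator)
    qed
    also have "\<dots> = (\<integral>\<^sup>+x. min (h x) (ennreal c) \<partial>lborel)"
      using c by (intro nn_integral_layer_cake[symmetric]) auto
    also have "\<dots> \<le> (\<integral>\<^sup>+x. h x \<partial>lborel)"
      by (intro nn_integral_mono) auto
    finally have H: "ennreal c * ?F h c \<le> (\<integral>\<^sup>+x. h x \<partial>lborel)" .
    have "(\<integral>\<^sup>+x. f x \<partial>lborel) * (\<integral>\<^sup>+x. g x \<partial>lborel) = ennreal (a * b) * (?F f a * ?F g b)"
      using nn_integral_layer_cake[OF meas(1) 3(1) fa] nn_integral_layer_cake[OF meas(2) 3(2) gb] 3
      by (simp add: ennreal_mult ac_simps)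
    also have "\<dots> \<le> ennreal (c\<^sup>2) * (?F h c)\<^sup>2"
      unfolding c(2) by (intro mult_left_mono FGH) auto
    also have "\<dots> = (ennreal c * ?F h c)\<^sup>2"
      using c(1) by (simp add: power_mult_distrib ennreal_power)
    also have "\<dots> \<le> (\<integral>\<^sup>+x. h x \<partial>lborel)\<^sup>2"
      by (intro power_mono H) auto
    finally show ?thesis .
  qed
qed

lemma nn_integral_SUP_truncate:
  assumes [measurable]: "f \<in> borel_measurable M"
  shows "(\<integral>\<^sup>+x. f x \<partial>M) = (SUP n. \<integral>\<^sup>+x. min (f x) (ennreal (real n)) \<partial>M)"
proof -
  have "f x = (SUP n. min (f x) (ennreal (real n)))" for x
  proof (rule antisym)
    show "f x \<le> (SUP n. min (f x) (ennreal (real n)))"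
      unfolding le_SUP_iff
    proof (intro allI impI)
      fix y assume y: "y < f x"
      then have "y < \<top>" by (rule less_le_trans) simp
      then obtain n where "y < of_nat n" using ennreal_Ex_less_of_nat by blast
      with y show "\<exists>n\<in>UNIV. y < min (f x) (ennreal (real n))"
        by (auto simp: ennreal_of_nat_eq_real_of_nat)
    qed
  qed (auto intro: SUP_least)
  then have "(\<integral>\<^sup>+x. f x \<partial>M) = (\<integral>\<^sup>+x. (SUP n. min (f x) (ennreal (real n))) \<partial>M)"
    by (intro nn_integral_cong)
  also have "\<dots> = (SUP n. \<integral>\<^sup>+x. min (f x) (ennreal (real n)) \<partial>M)"
    by (intro nn_integral_monotone_convergence_SUP)
      (auto simp: incseq_def le_fun_def min_le_iff_disj intro!: ennreal_leI)
  finally show ?thesis .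
qed

lemma prekopa_leindler_real:
  fixes f g h :: "real \<Rightarrow> ennreal"
  assumes meas[measurable]: "f \<in> borel_measurable borel" "g \<in> borel_measurable borel" "h \<in> borel_measurable borel"
    and mid: "\<And>x y. f x * g y \<le> (h ((x + y) / 2))\<^sup>2"
  shows "(\<integral>\<^sup>+x. f x \<partial>lborel) * (\<integral>\<^sup>+x. g x \<partial>lborel) \<le> (\<integral>\<^sup>+x. h x \<partial>lborel)\<^sup>2"
proof -
  let ?T = "\<lambda>u n. \<integral>\<^sup>+x. min (u x) (ennreal (real n)) \<partial>lborel"
  have tr: "?T f m * ?T g n \<le> (\<integral>\<^sup>+x. h x \<partial>lborel)\<^sup>2" for m n
  proof (rule prekopa_leindler_real_bounded)
    show "min (f x) (ennreal (real m)) * min (g y) (ennreal (real n)) \<le> (h ((x + y) / 2))\<^sup>2" for x y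
      using mid[of x y] by (rule order_trans[rotated]) (intro mult_mono, auto)
    show "min (f x) (ennreal (real m)) \<le> ennreal (real (max m n))" for x
      by (auto simp: min_le_iff_disj intro!: ennreal_leI)
    show "min (g x) (ennreal (real n)) \<le> ennreal (real (max m n))" for x
      by (auto simp: min_le_iff_disj intro!: ennreal_leI)
  qed auto
  have 1: "(\<integral>\<^sup>+x. f x \<partial>lborel) = (SUP n. ?T f n)" and 2: "(\<integral>\<^sup>+x. g x \<partial>lborel) = (SUP n. ?T g n)"
    by (rule nn_integral_SUP_truncate, simp)+
  show ?thesis
    unfolding 1 2 by (simp only: SUP_mult_right_ennreal SUP_mult_left_ennreal) (intro SUP_least tr)
qed

text \<open>
  Induction on the number of coordinates: for fixed remaining coordinates the one-dimensional
  inequality shows that integrating out one coordinate preserves the midpoint hypothesis.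
\<close>
lemma prekopa_leindler_PiM:
  fixes I :: "'i set" and f g h :: "('i \<Rightarrow> real) \<Rightarrow> ennreal"
  assumes "finite I"
    and "f \<in> borel_measurable (Pi\<^sub>M I (\<lambda>_. lborel))" "g \<in> borel_measurable (Pi\<^sub>M I (\<lambda>_. lborel))"
      "h \<in> borel_measurable (Pi\<^sub>M I (\<lambda>_. lborel))"
    and "\<And>x y. x \<in> extensional I \<Longrightarrow> y \<in> extensional I \<Longrightarrow> f x * g y \<le> (h (\<lambda>i\<in>I. (x i + y i) / 2))\<^sup>2"
  shows "(\<integral>\<^sup>+x. f x \<partial>Pi\<^sub>M I (\<lambda>_. lborel)) * (\<integral>\<^sup>+x. g x \<partial>Pi\<^sub>M I (\<lambda>_. lborel))
    \<le> (\<integral>\<^sup>+x. h x \<partial>Pi\<^sub>M I (\<lambda>_. lborel))\<^sup>2"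
  using assms
proof (induction I arbitrary: f g h rule: finite_induct)
  case empty
  have "(\<lambda>i\<in>{}. ((\<lambda>_. undefined) i + (\<lambda>_. undefined) i) / 2) = ((\<lambda>_. undefined) :: 'i \<Rightarrow> real)"
    by auto
  with empty(4)[of "\<lambda>_. undefined" "\<lambda>_. undefined"] show ?case
    by (simp add: PiM_empty nn_integral_count_space_finite)
next
  case (insert i I)
  note [measurable] = insert.prems(1-3)
  interpret product_sigma_finite "\<lambda>_. lborel :: real measure" ..
  let ?M = "Pi\<^sub>M I (\<lambda>_. lborel :: real measure)"
  have split: "(\<integral>\<^sup>+x. u x \<partial>Pi\<^sub>M (insert i I) (\<lambda>_. lborel)) = (\<integral>\<^sup>+x. \<integral>\<^sup>+a. u (x(i := a)) \<partial>lborel \<partial>?M)"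
    if "u \<in> borel_measurable (Pi\<^sub>M (insert i I) (\<lambda>_. lborel))" for u :: "_ \<Rightarrow> ennreal"
    using insert.hyps that by (rule product_nn_integral_insert)
  have slice: "(\<lambda>a. u (x(i := a))) \<in> borel_measurable borel"
    if [measurable]: "u \<in> borel_measurable (Pi\<^sub>M (insert i I) (\<lambda>_. lborel))" and x: "x \<in> extensional I"
    for u :: "_ \<Rightarrow> ennreal" and x :: "'i \<Rightarrow> real"
  proof -
    have "x \<in> space ?M" using x by (auto simp: space_PiM PiE_def)
    then have "(\<lambda>a. u (x(i := a))) \<in> borel_measurable lborel" by measurable
    then show ?thesis by simp
  qed
  show ?case
    unfolding split[OF insert.prems(1)] split[OF insert.prems(2)] split[OF insert.prems(3)]
  proof (rule insert.IH)
    fix x y :: "'i \<Rightarrow> real" assume xy: "x \<in> extensional I" "y \<in> extensional I"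
    let ?m = "\<lambda>j\<in>I. (x j + y j) / 2"
    show "(\<integral>\<^sup>+a. f (x(i := a)) \<partial>lborel) * (\<integral>\<^sup>+a. g (y(i := a)) \<partial>lborel) \<le> (\<integral>\<^sup>+a. h (?m(i := a)) \<partial>lborel)\<^sup>2"
    proof (rule prekopa_leindler_real)
      fix a b
      have "(\<lambda>j\<in>insert i I. ((x(i := a)) j + (y(i := b)) j) / 2) = ?m(i := (a + b) / 2)"
        using insert.hyps by (auto simp: restrict_def)
      moreover have "x(i := a) \<in> extensional (insert i I)" "y(i := b) \<in> extensional (insert i I)"
        using xy by (auto simp: extensional_def)
      ultimately show "f (x(i := a)) * g (y(i := b)) \<le> (h (?m(i := (a + b) / 2)))\<^sup>2"
        using insert.prems(4) by metis
    qed (use xy insert.prems in \<open>auto intro!: slice\<close>)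
  qed measurable
qed

lemma prekopa_leindler:
  fixes f g h :: "'a::euclidean_space \<Rightarrow> ennreal"
  assumes [measurable]: "f \<in> borel_measurable borel" "g \<in> borel_measurable borel" "h \<in> borel_measurable borel"
    and mid: "\<And>x y. f x * g y \<le> (h ((1/2) *\<^sub>R (x + y)))\<^sup>2"
  shows "(\<integral>\<^sup>+x. f x \<partial>lborel) * (\<integral>\<^sup>+x. g x \<partial>lborel) \<le> (\<integral>\<^sup>+x. h x \<partial>lborel)\<^sup>2"
proof -
  let ?e = "\<lambda>x. \<Sum>b\<in>Basis. x b *\<^sub>R b :: 'a"
  have [measurable]: "?e \<in> Pi\<^sub>M Basis (\<lambda>_. lborel) \<rightarrow>\<^sub>M borel" by measurable
  have tr: "(\<integral>\<^sup>+x. u x \<partial>lborel) = (\<integral>\<^sup>+x. u (?e x) \<partial>Pi\<^sub>M Basis (\<lambda>_. lborel))"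
    if [measurable]: "u \<in> borel_measurable borel" for u :: "'a \<Rightarrow> ennreal"
    by (subst lborel_eq) (simp add: nn_integral_distr)
  show ?thesis
    unfolding tr[OF assms(1)] tr[OF assms(2)] tr[OF assms(3)]
  proof (rule prekopa_leindler_PiM)
    fix x y :: "'a \<Rightarrow> real"
    have "?e (\<lambda>i\<in>Basis. (x i + y i) / 2) = (1/2) *\<^sub>R (?e x + ?e y)"
      unfolding sum.distrib[symmetric] scaleR_sum_right
      by (intro sum.cong) (auto simp: scaleR_add_left[symmetric])
    then show "f (?e x) * g (?e y) \<le> (h (?e (\<lambda>i\<in>Basis. (x i + y i) / 2)))\<^sup>2"
      using mid[of "?e x" "?e y"] by simp
  qed auto
qed

section \<open>Log-concave functions\<close>

text \<open>
  The remaining cases of the defining inequality are trivial: if a value of \<open>\<theta>\<close> is zero, the product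
  vanishes because \<open>0 powr s = 0\<close>, and if a weight is zero, both sides coincide for positive values.
\<close>
lemma log_concave_funI:
  assumes "\<And>x. 0 \<le> \<theta> x"
    and "\<And>x y s t. 0 < \<theta> x \<Longrightarrow> 0 < \<theta> y \<Longrightarrow> 0 < s \<Longrightarrow> 0 < t \<Longrightarrow> s + t = 1 \<Longrightarrow>
      \<theta> x powr s * \<theta> y powr t \<le> \<theta> (s *\<^sub>R x + t *\<^sub>R y)"
  shows "log_concave_fun \<theta>"
  unfolding log_concave_fun_def
proof (intro conjI allI impI assms(1), elim conjE)
  fix x y and s t :: real assume st: "0 \<le> s" "0 \<le> t" "s + t = 1"
  show "\<theta> x powr s * \<theta> y powr t \<le> \<theta> (s *\<^sub>R x + t *\<^sub>R y)"
  proof (cases "\<theta> x = 0 \<or> \<theta> y = 0")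
    case True
    then show ?thesis using assms(1) by auto
  next
    case False
    then have pos: "0 < \<theta> x" "0 < \<theta> y" using assms(1)[of x] assms(1)[of y] by auto
    consider "s = 0" "t = 1" | "t = 0" "s = 1" | "0 < s" "0 < t" using st by linarith
    then show ?thesis
      using pos st assms(2) by cases auto
  qed
qed

lemma log_concave_funD:
  assumes "log_concave_fun \<theta>"
  shows "0 \<le> \<theta> x"
    and "0 \<le> s \<Longrightarrow> 0 \<le> t \<Longrightarrow> s + t = 1 \<Longrightarrow> \<theta> x powr s * \<theta> y powr t \<le> \<theta> (s *\<^sub>R x + t *\<^sub>R y)"
  using assms by (auto simp: log_concave_fun_def)

lemma log_concave_fun_limit:
  assumes lc: "\<And>n. n \<ge> N \<Longrightarrow> log_concave_fun (F n)"
    and lim: "\<And>x. (\<lambda>n. F n x) \<longlonglongrightarrow> G x"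
  shows "log_concave_fun G"
proof (rule log_concave_funI)
  show "0 \<le> G x" for x
    by (rule tendsto_lowerbound[OF lim]) (auto intro!: eventually_sequentiallyI[of N] log_concave_funD(1)[OF lc])
  fix x y s t assume *: "0 < G x" "0 < G y" "0 < s" "0 < t" "s + t = (1::real)"
  show "G x powr s * G y powr t \<le> G (s *\<^sub>R x + t *\<^sub>R y)"
  proof (rule tendsto_le[OF _ lim])
    show "(\<lambda>n. F n x powr s * F n y powr t) \<longlonglongrightarrow> G x powr s * G y powr t"
      using * by (intro tendsto_intros lim) auto
    show "\<forall>\<^sub>F n in sequentially. F n x powr s * F n y powr t \<le> F n (s *\<^sub>R x + t *\<^sub>R y)"
      using * by (intro eventually_sequentiallyI[of N] log_concave_funD(2)[OF lc]) auto
  qed simp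
qed

lemma log_concave_fun_midpoint:
  assumes "log_concave_fun \<theta>"
  shows "\<theta> x * \<theta> y \<le> (\<theta> ((1/2) *\<^sub>R (x + y)))\<^sup>2"
proof -
  note nn = log_concave_funD(1)[OF assms]
  have "sqrt (\<theta> x) * sqrt (\<theta> y) \<le> \<theta> ((1/2) *\<^sub>R (x + y))"
    using log_concave_funD(2)[OF assms, of "1/2" "1/2" x y] nn
    by (simp add: powr_half_sqrt scaleR_add_right)
  then have "(sqrt (\<theta> x) * sqrt (\<theta> y))\<^sup>2 \<le> (\<theta> ((1/2) *\<^sub>R (x + y)))\<^sup>2"
    using nn by (intro power_mono) auto
  then show ?thesis using nn by (simp add: power_mult_distrib)
qed

text \<open>
  A point of \<open>[0, 1]\<close> outside \<open>D\<close> would lie in a gap of \<open>D\<close> whose two ends belong to \<open>D\<close>, and the midpoint of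
  this gap contradicts the hypothesis.
\<close>
lemma closed_midpoint_set_unit_interval:
  fixes D :: "real set"
  assumes "closed D" "0 \<in> D" "1 \<in> D"
    and mid: "\<And>a b. a \<in> D \<Longrightarrow> b \<in> D \<Longrightarrow> (a + b) / 2 \<in> D"
  shows "{0..1} \<subseteq> D"
proof
  fix s :: real assume s: "s \<in> {0..1}"
  have "compact (D \<inter> {0..s})" "compact (D \<inter> {s..1})"
    using \<open>closed D\<close> by (auto intro: closed_Int_compact)
  moreover have "D \<inter> {0..s} \<noteq> {}" "D \<inter> {s..1} \<noteq> {}" using assms s by auto
  ultimately obtain a b where a: "a \<in> D \<inter> {0..s}" "\<And>x. x \<in> D \<inter> {0..s} \<Longrightarrow> x \<le> a"
    and b: "b \<in> D \<inter> {s..1}" "\<And>x. x \<in> D \<inter> {s..1} \<Longrightarrow> b \<le> x"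
    by (metis compact_attains_sup compact_attains_inf)
  have m: "(a + b) / 2 \<in> D" using a b mid by auto
  show "s \<in> D"
  proof (cases "(a + b) / 2 \<le> s")
    case True
    then have "(a + b) / 2 \<le> a" using a b m s by (intro a(2)) auto
    then have "s = a" using a b by auto
    then show ?thesis using a(1) by simp
  next
    case False
    then have "b \<le> (a + b) / 2" using a b m s by (intro b(2)) auto
    then have "s = b" using a b by auto
    then show ?thesis using b(1) by simp
  qed
qed

text \<open>
  On the segment from \<open>y\<close> to \<open>x\<close>, the weights \<open>s\<close> for which the inequality of log-concavity holds
  form a closed set containing both ends and stable under midpoints.  Comparing \<open>u\<close> with the
  geometric interpolation of its end values, instead of taking logarithms, allows \<open>u\<close> to vanish
  inside the segment.
\<close>
lemma log_concave_fun_of_midpoint: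
  fixes u :: "'a::euclidean_space \<Rightarrow> real"
  assumes cont: "continuous_on UNIV u" and nn: "\<And>x. 0 \<le> u x"
    and mid: "\<And>x y. u x * u y \<le> (u ((1/2) *\<^sub>R (x + y)))\<^sup>2"
  shows "log_concave_fun u"
proof (rule log_concave_funI[OF nn])
  fix x y s t assume *: "0 < u x" "0 < u y" "0 < s" "0 < t" "s + t = (1::real)"
  define p where "p = (\<lambda>s::real. u (s *\<^sub>R x + (1 - s) *\<^sub>R y))"
  define q where "q = (\<lambda>s::real. u x powr s * u y powr (1 - s))"
  define D where "D = {s. q s \<le> p s}"
  have "{0..1} \<subseteq> D"
  proof (rule closed_midpoint_set_unit_interval)
    have "continuous_on UNIV p" unfolding p_def
      by (intro continuous_on_compose2[OF cont] continuous_intros) auto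
    moreover have "continuous_on UNIV q" unfolding q_def
      using * by (intro continuous_intros) auto
    ultimately show "closed D" unfolding D_def by (intro closed_Collect_le)
    show "0 \<in> D" "1 \<in> D" using * by (auto simp: D_def p_def q_def)
    fix a b assume "a \<in> D" "b \<in> D"
    then have ab: "q a \<le> p a" "q b \<le> p b" by (auto simp: D_def)
    have q0: "0 \<le> q c" for c by (auto simp: q_def)
    have "(q ((a + b) / 2))\<^sup>2 = u x powr ((a + b) / 2 + (a + b) / 2) * u y powr ((1 - (a + b) / 2) + (1 - (a + b) / 2))"
      unfolding powr_add by (simp add: q_def power2_eq_square ac_simps)
    also have "\<dots> = u x powr (a + b) * u y powr ((1 - a) + (1 - b))"
      by (intro arg_cong2[where f="(*)"] arg_cong2[where f="(powr)"] refl) (auto simp: field_simps)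
    also have "\<dots> = q a * q b"
      unfolding powr_add by (simp add: q_def ac_simps)
    also have "\<dots> \<le> p a * p b" using ab q0[of a] q0[of b] nn by (intro mult_mono) (auto simp: p_def)
    also have "\<dots> \<le> (u ((1/2) *\<^sub>R ((a *\<^sub>R x + (1 - a) *\<^sub>R y) + (b *\<^sub>R x + (1 - b) *\<^sub>R y))))\<^sup>2"
      unfolding p_def by (rule mid)
    also have "(1/2) *\<^sub>R ((a *\<^sub>R x + (1 - a) *\<^sub>R y) + (b *\<^sub>R x + (1 - b) *\<^sub>R y)) =
        ((a + b) / 2) *\<^sub>R x + (1 - (a + b) / 2) *\<^sub>R y"
      by (rule euclidean_eqI) (auto simp: inner_simps field_simps)
    finally have "(q ((a + b) / 2))\<^sup>2 \<le> (p ((a + b) / 2))\<^sup>2"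
      by (simp add: p_def)
    then show "(a + b) / 2 \<in> D"
      using nn by (auto simp: D_def p_def intro: power2_le_imp_le)
  qed
  then have "s \<in> D" using * by auto
  moreover have "t = 1 - s" using * by simp
  ultimately show "u x powr s * u y powr t \<le> u (s *\<^sub>R x + t *\<^sub>R y)"
    by (simp add: D_def p_def q_def)
qed

lemma AE_lborel_near:
  fixes x :: "'a::euclidean_space"
  assumes "AE w in lborel. P w" "0 < e"
  obtains w where "P w" "dist x w < e"
proof (rule ccontr)
  assume "\<not> thesis"
  with that have "\<And>w. w \<in> ball x e \<Longrightarrow> \<not> P w" by auto
  moreover obtain N where N: "{w. \<not> P w} \<subseteq> N" "N \<in> null_sets lborel"
    using assms(1) by (auto elim!: AE_E simp: null_sets_def)
  ultimately have "ball x e \<subseteq> N" by blast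
  then have "negligible (ball x e)"
    using N(2) by (meson negligible_iff_null_sets negligible_subset null_sets_completionI)
  then show False using \<open>0 < e\<close> open_not_negligible[of "ball x e"] by auto
qed

lemma AE_lborel_translate:
  fixes c :: "'a::euclidean_space"
  assumes [measurable]: "Measurable.pred borel P" and "AE x in lborel. P x"
  shows "AE x in lborel. P (c + x)"
proof -
  have "AE x in distr lborel borel ((+) c). P x"
    using assms(2) unfolding lborel_distr_plus .
  then show ?thesis by (subst (asm) AE_distr_iff) auto
qed

text \<open>
  For almost every \<open>w\<close> the functions agree at \<open>x + w\<close>, \<open>y + w\<close> and \<open>s x + t y + w\<close> simultaneously.
  The inequality for \<open>h\<close> at these points is one for \<open>u\<close>, and continuity lets \<open>w\<close> tend to \<open>0\<close>.
\<close>
lemma log_concave_fun_of_AE_eq: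
  fixes u h :: "'a::euclidean_space \<Rightarrow> real"
  assumes cont: "continuous_on UNIV u" and [measurable]: "h \<in> borel_measurable borel"
    and h: "log_concave_fun h" and ae: "AE x in lborel. u x = h x"
    and nn: "\<And>x. 0 \<le> u x"
  shows "log_concave_fun u"
proof (rule log_concave_funI[OF nn])
  fix x y s t assume *: "0 < u x" "0 < u y" "0 < s" "0 < t" "s + t = (1::real)"
  define z where "z = s *\<^sub>R x + t *\<^sub>R y"
  have [measurable]: "u \<in> borel_measurable borel" using cont by (rule borel_measurable_continuous_onI)
  have "AE w in lborel. u (c + w) = h (c + w)" for c
    by (rule AE_lborel_translate[OF _ ae]) measurable
  from this[of x] this[of y] this[of z]
  have good: "AE w in lborel. u (x + w) = h (x + w) \<and> u (y + w) = h (y + w) \<and> u (z + w) = h (z + w)"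
    by eventually_elim auto
  have "\<exists>w. (u (x + w) = h (x + w) \<and> u (y + w) = h (y + w) \<and> u (z + w) = h (z + w)) \<and> dist 0 w < inverse (real (Suc n))"
    for n
    using AE_lborel_near[OF good, of "inverse (real (Suc n))" 0] by auto
  then obtain W where W: "\<And>n. u (x + W n) = h (x + W n) \<and> u (y + W n) = h (y + W n) \<and> u (z + W n) = h (z + W n)"
    "\<And>n. dist 0 (W n) < inverse (real (Suc n))" by metis
  have W0: "W \<longlonglongrightarrow> 0"
    using W(2) by (intro LIMSEQ_norm_0) (simp add: inverse_eq_divide)
  have lim: "(\<lambda>n. u (c + W n)) \<longlonglongrightarrow> u c" for c
  proof -
    have "(\<lambda>n. c + W n) \<longlonglongrightarrow> c + 0" by (intro tendsto_intros W0)
    then show ?thesis using continuous_on_tendsto_compose[OF cont] by simp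
  qed
  have "u x powr s * u y powr t \<le> u z"
  proof (rule tendsto_le[OF _ lim[of z]])
    show "(\<lambda>n. u (x + W n) powr s * u (y + W n) powr t) \<longlonglongrightarrow> u x powr s * u y powr t"
      using * by (intro tendsto_intros lim) auto
    have "s *\<^sub>R (x + w) + t *\<^sub>R (y + w) = z + w" for w
    proof -
      have "s *\<^sub>R (x + w) + t *\<^sub>R (y + w) = z + (s + t) *\<^sub>R w"
        by (simp add: z_def algebra_simps)
      then show ?thesis using * by simp
    qed
    then show "\<forall>\<^sub>F n in sequentially. u (x + W n) powr s * u (y + W n) powr t \<le> u (z + W n)"
      using log_concave_funD(2)[OF h, of s t "x + W n" "y + W n" for n] * W(1)
      by (intro always_eventually allI) simp
  qed simp
  then show "u x powr s * u y powr t \<le> u (s *\<^sub>R x + t *\<^sub>R y)" by (simp add: z_def)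
qed

section \<open>Convolution of a locally finite measure with a test function\<close>

locale locally_finite_borel =
  fixes \<nu> :: "'a::euclidean_space measure"
  assumes sets_eq[measurable_cong]: "sets \<nu> = sets borel"
    and finite_compact: "\<And>K. compact K \<Longrightarrow> emeasure \<nu> K < \<infinity>"

lemma (in locally_finite_borel) space_eq: "space \<nu> = UNIV"
  using sets_eq_imp_space_eq[OF sets_eq] by simp

sublocale locally_finite_borel \<subseteq> sigma_finite_measure \<nu>
proof
  show "\<exists>A. countable A \<and> A \<subseteq> sets \<nu> \<and> \<Union> A = space \<nu> \<and> (\<forall>a\<in>A. emeasure \<nu> a \<noteq> \<infinity>)"
  proof (intro exI[of _ "range (\<lambda>n::nat. cball 0 (real n))"] conjI)
    show "\<Union> (range (\<lambda>n::nat. cball 0 (real n))) = space \<nu>"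
      by (auto simp: space_eq real_arch_simple)
    show "\<forall>a\<in>range (\<lambda>n::nat. cball 0 (real n)). emeasure \<nu> a \<noteq> \<infinity>"
      using finite_compact[OF compact_cball] by (auto simp: less_top[symmetric])
  qed (auto simp: sets_eq)
qed

definition test_function :: "('a::euclidean_space \<Rightarrow> real) \<Rightarrow> bool" where
  "test_function \<theta> \<longleftrightarrow> log_concave_fun \<theta> \<and> continuous_on UNIV \<theta> \<and> compact (closure {x. \<theta> x \<noteq> 0})"

lemma continuous_compact_support_bounds:
  fixes \<theta> :: "'a::euclidean_space \<Rightarrow> real"
  assumes "continuous_on UNIV \<theta>" "compact (closure {x. \<theta> x \<noteq> 0})"
  obtains B R where "0 \<le> B" "0 \<le> R" "\<And>x. \<bar>\<theta> x\<bar> \<le> B" "\<And>x. \<theta> x \<noteq> 0 \<Longrightarrow> norm x \<le> R"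
proof -
  let ?K = "closure {x. \<theta> x \<noteq> 0}"
  have "bounded (\<theta> ` ?K)"
    using assms by (intro compact_imp_bounded compact_continuous_image continuous_on_subset[OF assms(1)]) auto
  then obtain B where B: "\<And>x. x \<in> ?K \<Longrightarrow> \<bar>\<theta> x\<bar> \<le> B" by (auto simp: bounded_iff)
  obtain R where R: "\<And>x. x \<in> ?K \<Longrightarrow> norm x \<le> R"
    using compact_imp_bounded[OF assms(2)] by (auto simp: bounded_iff)
  show thesis
  proof (rule that[of "max B 0" "max R 0"])
    show "\<bar>\<theta> x\<bar> \<le> max B 0" for x
      using B[of x] closure_subset[of "{x. \<theta> x \<noteq> 0}"] by (cases "\<theta> x = 0") auto
    show "norm x \<le> max R 0" if "\<theta> x \<noteq> 0" for x
      using R[of x] closure_subset[of "{x. \<theta> x \<noteq> 0}"] that by auto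
  qed auto
qed

context locally_finite_borel
begin

text \<open>
  The dominating function for all integrals of bounded functions supported in a fixed ball.
\<close>
lemma integrable_ball_bound: "integrable \<nu> (\<lambda>y. B * indicator (cball 0 R) y :: real)"
  using finite_compact[of "cball 0 R"] by (intro integrable_mult_right) (auto simp: sets_eq integrable_indicator_iff space_eq)

lemma integrable_bounded_support:
  fixes F :: "'a \<Rightarrow> real"
  assumes [measurable]: "F \<in> borel_measurable borel" and "\<And>y. \<bar>F y\<bar> \<le> B" "\<And>y. F y \<noteq> 0 \<Longrightarrow> norm y \<le> R"
  shows "integrable \<nu> F"
proof (rule Bochner_Integration.integrable_bound[OF integrable_ball_bound[of B R]])
  show "AE y in \<nu>. norm (F y) \<le> norm (B * indicator (cball 0 R) y)"
    using assms(2,3) by (intro AE_I2) (force simp: indicator_def abs_mult intro: order_trans)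
qed simp

lemma tendsto_integral_bounded_support:
  fixes F :: "nat \<Rightarrow> 'a \<Rightarrow> real"
  assumes [measurable]: "\<And>n. F n \<in> borel_measurable borel" "G \<in> borel_measurable borel"
    and b: "\<And>n y. \<bar>F n y\<bar> \<le> B" and r: "\<And>n y. F n y \<noteq> 0 \<Longrightarrow> norm y \<le> R"
    and lim: "\<And>y. (\<lambda>n. F n y) \<longlonglongrightarrow> G y"
  shows "(\<lambda>n. \<integral>y. F n y \<partial>\<nu>) \<longlonglongrightarrow> (\<integral>y. G y \<partial>\<nu>)"
proof (rule integral_dominated_convergence[OF _ _ integrable_ball_bound[of B R]])
  show "AE y in \<nu>. norm (F n y) \<le> B * indicator (cball 0 R) y" for n
    using b[of n] r[of n] by (intro AE_I2) (force simp: indicator_def)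
qed (auto intro: lim)

end

definition convolve :: "('a::euclidean_space \<Rightarrow> real) \<Rightarrow> 'a measure \<Rightarrow> 'a \<Rightarrow> real" where
  "convolve \<theta> \<nu> x = (\<integral>y. \<theta> (x - y) \<partial>\<nu>)"

context locally_finite_borel
begin

context
  fixes \<theta> :: "'a \<Rightarrow> real"
  assumes cont: "continuous_on UNIV \<theta>" and supp: "compact (closure {x. \<theta> x \<noteq> 0})"
    and nn: "\<And>x. 0 \<le> \<theta> x"
begin

lemma integrable_convolve: "integrable \<nu> (\<lambda>y. \<theta> (x - y))"
proof -
  obtain B R where BR: "0 \<le> B" "0 \<le> R" "\<And>x. \<bar>\<theta> x\<bar> \<le> B" "\<And>x. \<theta> x \<noteq> 0 \<Longrightarrow> norm x \<le> R"
    using continuous_compact_support_bounds[OF cont supp] by metis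
  note [measurable] = borel_measurable_continuous_onI[OF cont]
  show ?thesis
  proof (rule integrable_bounded_support)
    show "norm y \<le> R + norm x" if "\<theta> (x - y) \<noteq> 0" for y
      using BR(4)[OF that] norm_triangle_ineq2[of y x] by (simp add: norm_minus_commute)
  qed (auto intro: BR)
qed

lemma convolve_nonneg: "0 \<le> convolve \<theta> \<nu> x"
  unfolding convolve_def by (intro Bochner_Integration.integral_nonneg nn)

lemma ennreal_convolve: "ennreal (convolve \<theta> \<nu> x) = (\<integral>\<^sup>+y. ennreal (\<theta> (x - y)) \<partial>\<nu>)"
  unfolding convolve_def
  by (intro nn_integral_eq_integral[symmetric] integrable_convolve AE_I2 nn)

lemma continuous_convolve: "continuous_on UNIV (convolve \<theta> \<nu>)"
proof (unfold continuous_on_sequentially, intro ballI allI impI, elim conjE)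
  fix X x assume "X \<longlonglongrightarrow> (x::'a)"
  obtain B R where BR: "0 \<le> B" "0 \<le> R" "\<And>x. \<bar>\<theta> x\<bar> \<le> B" "\<And>x. \<theta> x \<noteq> 0 \<Longrightarrow> norm x \<le> R"
    using continuous_compact_support_bounds[OF cont supp] by metis
  have "bounded (range X)" using \<open>X \<longlonglongrightarrow> x\<close> by (intro convergent_imp_bounded)
  then obtain r where r: "\<And>n. norm (X n) \<le> r" by (auto simp: bounded_iff)
  note [measurable] = borel_measurable_continuous_onI[OF cont]
  have "(\<lambda>n. \<integral>y. \<theta> (X n - y) \<partial>\<nu>) \<longlonglongrightarrow> (\<integral>y. \<theta> (x - y) \<partial>\<nu>)"
  proof (rule tendsto_integral_bounded_support)
    show "norm y \<le> R + r" if "\<theta> (X n - y) \<noteq> 0" for n y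
      using BR(4)[OF that] norm_triangle_ineq2[of y "X n"] r[of n] by (simp add: norm_minus_commute)
    show "(\<lambda>n. \<theta> (X n - y)) \<longlonglongrightarrow> \<theta> (x - y)" for y
      by (rule continuous_on_tendsto_compose[OF cont]) (auto intro!: tendsto_intros \<open>X \<longlonglongrightarrow> x\<close>)
  qed (auto intro: BR)
  then show "(convolve \<theta> \<nu> \<circ> X) \<longlonglongrightarrow> convolve \<theta> \<nu> x" by (simp add: convolve_def[abs_def] o_def)
qed

end
end

lemma nn_integral_lborel_shift:
  fixes u :: "'a::euclidean_space \<Rightarrow> ennreal"
  assumes [measurable]: "u \<in> borel_measurable borel"
  shows "(\<integral>\<^sup>+x. u (c + x) \<partial>lborel) = (\<integral>\<^sup>+x. u x \<partial>lborel)"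
proof -
  have "(\<integral>\<^sup>+x. u x \<partial>lborel) = (\<integral>\<^sup>+x. u x \<partial>distr lborel borel ((+) c))"
    unfolding lborel_distr_plus ..
  also have "\<dots> = (\<integral>\<^sup>+x. u (c + x) \<partial>lborel)" by (simp add: nn_integral_distr)
  finally show ?thesis ..
qed

text \<open>
  Fubini's theorem and the translation invariance of Lebesgue measure.
\<close>
lemma convolution_eq_density:
  fixes \<nu> :: "'a::ordered_euclidean_space measure"
  assumes "locally_finite_borel \<nu>" and cont: "continuous_on UNIV \<theta>"
    and supp: "compact (closure {x. \<theta> x \<noteq> 0})" and nn: "\<And>x. 0 \<le> \<theta> x"
  shows "(density lborel (\<lambda>x. ennreal (\<theta> x)) \<star> \<nu>) = density lborel (\<lambda>x. ennreal (convolve \<theta> \<nu> x))"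
proof (rule measure_eqI)
  interpret locally_finite_borel \<nu> by fact
  interpret P: pair_sigma_finite lborel \<nu> ..
  have [measurable]: "\<theta> \<in> borel_measurable borel"
    using cont by (rule borel_measurable_continuous_onI)
  have [measurable]: "convolve \<theta> \<nu> \<in> borel_measurable borel"
    by (rule borel_measurable_continuous_onI[OF continuous_convolve[OF cont supp nn]])
  fix A assume "A \<in> sets (density lborel (\<lambda>x. ennreal (\<theta> x)) \<star> \<nu>)"
  then have [measurable]: "A \<in> sets borel" by simp
  have "emeasure (density lborel (\<lambda>x. ennreal (\<theta> x)) \<star> \<nu>) A =
      (\<integral>\<^sup>+z. indicator A z \<partial>(density lborel (\<lambda>x. ennreal (\<theta> x)) \<star> \<nu>))"
    by simp
  also have "\<dots> = (\<integral>\<^sup>+p. indicator A (fst p + snd p) \<partial>(density lborel (\<lambda>x. ennreal (\<theta> x)) \<Otimes>\<^sub>M \<nu>))"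
    unfolding convolution_def by (subst nn_integral_distr) (auto simp: case_prod_beta)
  also have "\<dots> = (\<integral>\<^sup>+x. \<integral>\<^sup>+y. indicator A (x + y) \<partial>\<nu> \<partial>density lborel (\<lambda>x. ennreal (\<theta> x)))"
    by (subst nn_integral_fst[symmetric]) auto
  also have "\<dots> = (\<integral>\<^sup>+x. ennreal (\<theta> x) * (\<integral>\<^sup>+y. indicator A (x + y) \<partial>\<nu>) \<partial>lborel)"
    by (subst nn_integral_density) auto
  also have "\<dots> = (\<integral>\<^sup>+x. (\<integral>\<^sup>+y. ennreal (\<theta> x) * indicator A (x + y) \<partial>\<nu>) \<partial>lborel)"
    by (intro nn_integral_cong nn_integral_cmult[symmetric]) auto
  also have "\<dots> = (\<integral>\<^sup>+y. (\<integral>\<^sup>+x. ennreal (\<theta> x) * indicator A (x + y) \<partial>lborel) \<partial>\<nu>)"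
    by (rule P.Fubini'[symmetric]) auto
  also have "\<dots> = (\<integral>\<^sup>+y. (\<integral>\<^sup>+x. ennreal (\<theta> (x - y)) * indicator A x \<partial>lborel) \<partial>\<nu>)"
  proof (rule nn_integral_cong)
    fix y
    show "(\<integral>\<^sup>+x. ennreal (\<theta> x) * indicator A (x + y) \<partial>lborel) = (\<integral>\<^sup>+x. ennreal (\<theta> (x - y)) * indicator A x \<partial>lborel)"
      using nn_integral_lborel_shift[of "\<lambda>x. ennreal (\<theta> (x - y)) * indicator A x" y]
      by (simp add: add.commute)
  qed
  also have "\<dots> = (\<integral>\<^sup>+x. (\<integral>\<^sup>+y. ennreal (\<theta> (x - y)) * indicator A x \<partial>\<nu>) \<partial>lborel)"
    by (rule P.Fubini') auto
  also have "\<dots> = (\<integral>\<^sup>+x. ennreal (convolve \<theta> \<nu> x) * indicator A x \<partial>lborel)"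
    by (intro nn_integral_cong) (simp add: nn_integral_multc ennreal_convolve[OF cont supp nn])
  also have "\<dots> = emeasure (density lborel (\<lambda>x. ennreal (convolve \<theta> \<nu> x))) A"
    by (simp add: emeasure_density)
  finally show "emeasure (density lborel (\<lambda>x. ennreal (\<theta> x)) \<star> \<nu>) A =
      emeasure (density lborel (\<lambda>x. ennreal (convolve \<theta> \<nu> x))) A" .
qed simp

text \<open>
  Any two densities of \<open>\<theta> \<star> \<nu>\<close> agree almost everywhere, and \<open>convolve \<theta> \<nu>\<close> is a continuous one, so the
  existence of a log-concave density forces \<open>convolve \<theta> \<nu>\<close> to be log-concave.
\<close>
lemma log_concave_measure_iff_convolve:
  fixes \<nu> :: "'a::ordered_euclidean_space measure"
  assumes lf: "locally_finite_borel \<nu>"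
  shows "log_concave_measure \<nu> \<longleftrightarrow> (\<forall>\<theta>. test_function \<theta> \<longrightarrow> log_concave_fun (convolve \<theta> \<nu>))"
proof -
  have "(\<exists>h. h \<in> borel_measurable borel \<and> log_concave_fun h \<and>
      (density lborel (\<lambda>x. ennreal (\<theta> x)) \<star> \<nu>) = density lborel (\<lambda>x. ennreal (h x))) \<longleftrightarrow>
      log_concave_fun (convolve \<theta> \<nu>)" (is "?L \<longleftrightarrow> ?R")
    if "test_function \<theta>" for \<theta>
  proof -
    interpret locally_finite_borel \<nu> by fact
    have \<theta>: "continuous_on UNIV \<theta>" "compact (closure {x. \<theta> x \<noteq> 0})" "\<And>x. 0 \<le> \<theta> x"
      using that by (auto simp: test_function_def log_concave_fun_def)
    note cc = continuous_convolve[OF \<theta>] and cn = convolve_nonneg[OF \<theta>]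
    have [measurable]: "convolve \<theta> \<nu> \<in> borel_measurable borel"
      by (rule borel_measurable_continuous_onI[OF cc])
    show ?thesis
    proof
      assume ?R
      then show ?L using convolution_eq_density[OF lf \<theta>] by (intro exI[of _ "convolve \<theta> \<nu>"]) simp
    next
      assume ?L
      then obtain h where h[measurable]: "h \<in> borel_measurable borel" and lc: "log_concave_fun h"
        and eq: "(density lborel (\<lambda>x. ennreal (\<theta> x)) \<star> \<nu>) = density lborel (\<lambda>x. ennreal (h x))" by blast
      have "AE x in lborel. ennreal (convolve \<theta> \<nu> x) = ennreal (h x)"
        using eq unfolding convolution_eq_density[OF lf \<theta>] by (subst (asm) sigma_finite_measure.density_unique_iff[OF lborel.sigma_finite_measure_axioms]) auto
      then have "AE x in lborel. convolve \<theta> \<nu> x = h x"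
        by eventually_elim (simp add: cn log_concave_funD(1)[OF lc])
      then show ?R by (rule log_concave_fun_of_AE_eq[OF cc h lc _ cn])
    qed
  qed
  then show ?thesis
    unfolding log_concave_measure_def test_function_def by blast
qed

section \<open>Multiplication of a log-concave measure by a log-concave weight\<close>

text \<open>
  The deficit in the convexity of the squared norm is \<open>s t |x - y|\<^sup>2\<close>.
\<close>
lemma log_concave_fun_gaussian:
  fixes c :: real
  assumes "0 \<le> c"
  shows "log_concave_fun (\<lambda>x::'a::euclidean_space. exp (- c * (norm x)\<^sup>2))"
proof (rule log_concave_funI)
  fix x y :: 'a and s t :: real assume *: "0 < s" "0 < t" "s + t = 1"
  have "s * (norm x)\<^sup>2 + t * (norm y)\<^sup>2 - (norm (s *\<^sub>R x + t *\<^sub>R y))\<^sup>2 = s * t * (norm (x - y))\<^sup>2"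
  proof -
    have t: "t = 1 - s" using * by simp
    show ?thesis unfolding t power2_norm_eq_inner
      by (simp add: inner_simps inner_commute algebra_simps power2_eq_square)
  qed
  moreover have "0 \<le> s * t * (norm (x - y))\<^sup>2" using * by simp
  ultimately have "(norm (s *\<^sub>R x + t *\<^sub>R y))\<^sup>2 \<le> s * (norm x)\<^sup>2 + t * (norm y)\<^sup>2" by linarith
  then have "c * (norm (s *\<^sub>R x + t *\<^sub>R y))\<^sup>2 \<le> c * (s * (norm x)\<^sup>2 + t * (norm y)\<^sup>2)"
    using assms by (rule mult_left_mono)
  then show "exp (- c * (norm x)\<^sup>2) powr s * exp (- c * (norm y)\<^sup>2) powr t \<le> exp (- c * (norm (s *\<^sub>R x + t *\<^sub>R y))\<^sup>2)"
    by (simp add: exp_powr_real exp_add[symmetric] algebra_simps)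
qed simp

text \<open>
  A log-concave mollifier without its normalising constant; the family is obtained by scaling,
  \<open>tent m u = tent 1 (m u)\<close> for \<open>m > 0\<close>, so that one constant \<open>\<integral>tent 1\<close> serves for all \<open>m\<close>.
\<close>
definition tent :: "real \<Rightarrow> 'a::euclidean_space \<Rightarrow> real" where
  "tent m u = max 0 (1 - m * norm u)"

lemma tent_bounds: "0 \<le> tent m u" "tent m u \<noteq> 0 \<Longrightarrow> m * norm u \<le> 1"
  by (auto simp: tent_def)

lemma continuous_tent: "continuous_on UNIV (tent m)"
  unfolding tent_def[abs_def] by (intro continuous_intros)

lemma measurable_tent[measurable]: "tent m \<in> borel_measurable borel"
  by (rule borel_measurable_continuous_onI[OF continuous_tent])

text \<open>
  The positive part of a concave function is log-concave by the weighted arithmetic-geometric mean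
  inequality.
\<close>
lemma test_function_tent:
  assumes m: "0 < m"
  shows "test_function (tent m :: 'a::euclidean_space \<Rightarrow> real)"
  unfolding test_function_def
proof (intro conjI continuous_tent)
  show "log_concave_fun (tent m :: 'a \<Rightarrow> real)"
  proof (rule log_concave_funI)
    fix x y :: 'a and s t :: real
    assume *: "0 < tent m x" "0 < tent m y" "0 < s" "0 < t" "s + t = 1"
    have xy: "tent m x = 1 - m * norm x" "tent m y = 1 - m * norm y"
      using * by (auto simp: tent_def)
    have "tent m x powr s * tent m y powr t \<le> s * tent m x + t * tent m y"
      using * by (intro Youngs_inequality_0) auto
    also have "\<dots> = (s + t) - m * (norm (s *\<^sub>R x) + norm (t *\<^sub>R y))"
      using * unfolding xy by (simp add: algebra_simps)
    also have "\<dots> \<le> 1 - m * norm (s *\<^sub>R x + t *\<^sub>R y)"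
      using m * norm_triangle_ineq[of "s *\<^sub>R x" "t *\<^sub>R y"] by (simp only: *) simp
    also have "\<dots> \<le> tent m (s *\<^sub>R x + t *\<^sub>R y)" by (simp add: tent_def)
    finally show "tent m x powr s * tent m y powr t \<le> tent m (s *\<^sub>R x + t *\<^sub>R y)" .
  qed (simp add: tent_bounds)
  have "{x :: 'a. tent m x \<noteq> 0} \<subseteq> cball 0 (1 / m)"
    using m tent_bounds(2)[of m] by (auto simp: field_simps)
  then have "bounded {x :: 'a. tent m x \<noteq> 0}" by (rule bounded_subset[OF bounded_cball])
  then show "compact (closure {x :: 'a. tent m x \<noteq> 0})" by simp
qed

lemma nn_integral_tent:
  obtains c where "0 < c" "(\<integral>\<^sup>+u. ennreal (tent 1 (u :: 'a::euclidean_space)) \<partial>lborel) = ennreal c"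
proof -
  let ?C = "\<integral>\<^sup>+u. ennreal (tent 1 (u :: 'a)) \<partial>lborel"
  have "?C \<le> (\<integral>\<^sup>+u. indicator (cball 0 1) (u :: 'a) \<partial>lborel)"
    by (intro nn_integral_mono) (auto simp: tent_def indicator_def ennreal_neg)
  also have "\<dots> < \<top>" using emeasure_compact_finite[OF compact_cball] by simp
  finally have fin: "?C < \<top>" .
  have "?C \<noteq> 0"
  proof
    assume "?C = 0"
    then have "AE u in lborel. ennreal (tent 1 (u :: 'a)) = 0"
      by (subst (asm) nn_integral_0_iff_AE) auto
    then obtain w :: 'a where "ennreal (tent 1 w) = 0" "dist 0 w < 1"
      using AE_lborel_near[of "\<lambda>u. ennreal (tent 1 (u :: 'a)) = 0" 1 0] by auto
    then show False by (simp add: tent_def)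
  qed
  with fin that show thesis by (cases ?C) auto
qed

lemma nn_integral_lborel_affine:
  fixes f :: "'a::euclidean_space \<Rightarrow> ennreal"
  assumes [measurable]: "f \<in> borel_measurable borel" and m: "0 < m"
  shows "ennreal (m ^ DIM('a)) * (\<integral>\<^sup>+y. f y \<partial>lborel) = (\<integral>\<^sup>+v. f (z + (1 / m) *\<^sub>R v) \<partial>lborel)"
proof -
  have "(\<integral>\<^sup>+y. f y \<partial>lborel) = ennreal (\<bar>1 / m\<bar> ^ DIM('a)) * (\<integral>\<^sup>+v. f (z + (1 / m) *\<^sub>R v) \<partial>lborel)"
    using m by (subst lborel_affine[of "1 / m" z])
      (auto simp: nn_integral_density nn_integral_distr nn_integral_cmult)
  also have "ennreal (m ^ DIM('a)) * \<dots> = ennreal (m ^ DIM('a) * \<bar>1 / m\<bar> ^ DIM('a)) * (\<integral>\<^sup>+v. f (z + (1 / m) *\<^sub>R v) \<partial>lborel)"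
    using m by (subst ennreal_mult) (auto simp: mult.assoc)
  also have "m ^ DIM('a) * \<bar>1 / m\<bar> ^ DIM('a) = 1"
    using m by (simp add: power_mult_distrib[symmetric])
  finally show ?thesis by simp
qed

text \<open>
  With \<open>m = Suc n\<close> and the substitution \<open>y = z + v/m\<close>, the left-hand side equals
  \<open>\<integral>\<integral> w(z + v/m) tent 1 v dv \<nu>(dz)\<close>.  Dominated convergence applies first in \<open>v\<close> and then in \<open>z\<close>:
  for every \<open>n\<close> the inner integral vanishes for \<open>z\<close> outside a ball of radius one larger than that
  of the support of \<open>w\<close>.
\<close>
lemma (in locally_finite_borel) tendsto_mollified_nn_integral:
  fixes w :: "'a \<Rightarrow> real"
  assumes cont: "continuous_on UNIV w" and nn: "\<And>y. 0 \<le> w y"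
    and supp: "compact (closure {y. w y \<noteq> 0})"
  shows "(\<lambda>n. ennreal (real (Suc n) ^ DIM('a)) *
      (\<integral>\<^sup>+y. ennreal (w y * convolve (tent (real (Suc n))) \<nu> y) \<partial>lborel))
    \<longlonglongrightarrow> (\<integral>\<^sup>+u. ennreal (tent 1 (u::'a)) \<partial>lborel) * (\<integral>\<^sup>+z. ennreal (w z) \<partial>\<nu>)"
proof -
  interpret P: pair_sigma_finite lborel \<nu> ..
  have [measurable]: "w \<in> borel_measurable borel"
    using cont by (rule borel_measurable_continuous_onI)
  obtain B R where BR: "0 \<le> B" "0 \<le> R" "\<And>x. \<bar>w x\<bar> \<le> B" "\<And>x. w x \<noteq> 0 \<Longrightarrow> norm x \<le> R"
    using continuous_compact_support_bounds[OF cont supp] by metis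
  obtain c where c: "0 < c" "(\<integral>\<^sup>+u. ennreal (tent 1 (u :: 'a)) \<partial>lborel) = ennreal c"
    using nn_integral_tent by metis
  define V where "V n z = (\<integral>\<^sup>+v. ennreal (w (z + (1 / real (Suc n)) *\<^sub>R v) * tent 1 v) \<partial>lborel)" for n z
  have [measurable]: "V n \<in> borel_measurable borel" for n
    unfolding V_def by measurable
  have eq: "ennreal (real (Suc n) ^ DIM('a)) *
      (\<integral>\<^sup>+y. ennreal (w y * convolve (tent (real (Suc n))) \<nu> y) \<partial>lborel) = (\<integral>\<^sup>+z. V n z \<partial>\<nu>)" for n
  proof -
    let ?m = "real (Suc n)"
    have tf: "test_function (tent ?m :: 'a \<Rightarrow> real)" by (rule test_function_tent) simp
    have "(\<integral>\<^sup>+y. ennreal (w y * convolve (tent ?m) \<nu> y) \<partial>lborel) =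
        (\<integral>\<^sup>+y. (\<integral>\<^sup>+z. ennreal (w y * tent ?m (y - z)) \<partial>\<nu>) \<partial>lborel)"
    proof (rule nn_integral_cong)
      fix y
      have "ennreal (w y * convolve (tent ?m) \<nu> y) = ennreal (w y) * (\<integral>\<^sup>+z. ennreal (tent ?m (y - z)) \<partial>\<nu>)"
        using tf by (simp add: ennreal_mult' nn ennreal_convolve test_function_def tent_bounds)
      also have "\<dots> = (\<integral>\<^sup>+z. ennreal (w y * tent ?m (y - z)) \<partial>\<nu>)"
        by (subst nn_integral_cmult[symmetric]) (auto simp: ennreal_mult' nn)
      finally show "ennreal (w y * convolve (tent ?m) \<nu> y) = (\<integral>\<^sup>+z. ennreal (w y * tent ?m (y - z)) \<partial>\<nu>)" .
    qed
    also have "\<dots> = (\<integral>\<^sup>+z. (\<integral>\<^sup>+y. ennreal (w y * tent ?m (y - z)) \<partial>lborel) \<partial>\<nu>)"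
      by (rule P.Fubini'[symmetric]) auto
    finally have "ennreal (?m ^ DIM('a)) * (\<integral>\<^sup>+y. ennreal (w y * convolve (tent ?m) \<nu> y) \<partial>lborel) =
        (\<integral>\<^sup>+z. ennreal (?m ^ DIM('a)) * (\<integral>\<^sup>+y. ennreal (w y * tent ?m (y - z)) \<partial>lborel) \<partial>\<nu>)"
      by (simp only:) (rule nn_integral_cmult[symmetric], measurable)
    also have "\<dots> = (\<integral>\<^sup>+z. V n z \<partial>\<nu>)"
    proof (rule nn_integral_cong)
      fix z
      show "ennreal (?m ^ DIM('a)) * (\<integral>\<^sup>+y. ennreal (w y * tent ?m (y - z)) \<partial>lborel) = V n z"
        unfolding V_def by (subst nn_integral_lborel_affine[where z = z])
          (auto simp: tent_def simp del: of_nat_Suc)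
    qed
    finally show ?thesis .
  qed
  have V_lim: "(\<lambda>n. V n z) \<longlonglongrightarrow> ennreal c * ennreal (w z)" for z
  proof -
    have "(\<lambda>n. V n z) \<longlonglongrightarrow> (\<integral>\<^sup>+v. ennreal (w z * tent 1 (v::'a)) \<partial>lborel)"
      unfolding V_def
    proof (rule nn_integral_dominated_convergence)
      show "AE v in lborel. ennreal (w (z + (1 / real (Suc n)) *\<^sub>R v) * tent 1 v) \<le> ennreal (B * tent 1 v)" for n
        using BR by (intro AE_I2 ennreal_leI mult_right_mono) (auto simp: tent_bounds abs_le_iff)
      show "(\<integral>\<^sup>+v. ennreal (B * tent 1 (v::'a)) \<partial>lborel) < \<infinity>"
        using c BR(1) by (simp add: ennreal_mult' nn_integral_cmult ennreal_mult_less_top)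
      show "AE v in lborel. (\<lambda>n. ennreal (w (z + (1 / real (Suc n)) *\<^sub>R v) * tent 1 v)) \<longlonglongrightarrow> ennreal (w z * tent 1 v)"
      proof (intro AE_I2 tendsto_ennrealI tendsto_mult tendsto_const)
        fix v
        have "(\<lambda>n. z + inverse (real (Suc n)) *\<^sub>R v) \<longlonglongrightarrow> z + 0 *\<^sub>R v"
          by (intro tendsto_intros LIMSEQ_inverse_real_of_nat)
        then show "(\<lambda>n. w (z + (1 / real (Suc n)) *\<^sub>R v)) \<longlonglongrightarrow> w z"
          by (intro continuous_on_tendsto_compose[OF cont]) (auto simp: inverse_eq_divide)
      qed
    qed measurable
    then show ?thesis
      using c by (simp add: ennreal_mult' nn nn_integral_cmult mult.commute)
  qed
  have V_bound: "V n z \<le> ennreal (B * c) * indicator (cball 0 (R + 1)) z" for n z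
  proof (cases "norm z \<le> R + 1")
    case True
    have "V n z \<le> (\<integral>\<^sup>+v. ennreal (B * tent 1 (v::'a)) \<partial>lborel)"
      unfolding V_def using BR
      by (intro nn_integral_mono ennreal_leI mult_right_mono) (auto simp: tent_bounds abs_le_iff)
    also have "\<dots> = ennreal (B * c)"
      using c BR(1) by (simp add: ennreal_mult' nn_integral_cmult)
    finally show ?thesis using True by simp
  next
    case False
    have "w (z + (1 / real (Suc n)) *\<^sub>R v) * tent 1 v = 0" for v
    proof (rule ccontr)
      assume "w (z + (1 / real (Suc n)) *\<^sub>R v) * tent 1 v \<noteq> 0"
      then have "norm (z + (1 / real (Suc n)) *\<^sub>R v) \<le> R" "norm v \<le> 1"
        using BR(4) tent_bounds(2)[of 1 v] by auto
      moreover have "norm ((1 / real (Suc n)) *\<^sub>R v) \<le> norm v"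
        by (simp add: divide_le_eq mult_le_cancel_left1)
      moreover have "norm z \<le> norm (z + (1 / real (Suc n)) *\<^sub>R v) + norm ((1 / real (Suc n)) *\<^sub>R v)"
        using norm_triangle_ineq4[of "z + (1 / real (Suc n)) *\<^sub>R v" "(1 / real (Suc n)) *\<^sub>R v"] by simp
      ultimately show False using False by linarith
    qed
    then have "V n z = 0" unfolding V_def by (simp only: ennreal_0 nn_integral_const mult_zero_left)
    then show ?thesis by simp
  qed
  have "(\<lambda>n. \<integral>\<^sup>+z. V n z \<partial>\<nu>) \<longlonglongrightarrow> (\<integral>\<^sup>+z. ennreal c * ennreal (w z) \<partial>\<nu>)"
  proof (rule nn_integral_dominated_convergence)
    have [measurable]: "cball (0::'a) (R + 1) \<in> sets borel" by simp
    show "V n \<in> borel_measurable \<nu>" for n by measurable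
    show "(\<lambda>z. ennreal (B * c) * indicator (cball 0 (R + 1)) z) \<in> borel_measurable \<nu>" by measurable
    show "(\<lambda>z. ennreal c * ennreal (w z)) \<in> borel_measurable \<nu>" by measurable
    show "AE z in \<nu>. V n z \<le> ennreal (B * c) * indicator (cball 0 (R + 1)) z" for n
      by (intro AE_I2 V_bound)
    show "(\<integral>\<^sup>+z. ennreal (B * c) * indicator (cball 0 (R + 1)) z \<partial>\<nu>) < \<infinity>"
      using finite_compact[OF compact_cball, of 0 "R + 1"]
      by (subst nn_integral_cmult_indicator) (auto simp: sets_eq ennreal_mult_less_top)
    show "AE z in \<nu>. (\<lambda>n. V n z) \<longlonglongrightarrow> ennreal c * ennreal (w z)"
      by (intro AE_I2 V_lim)
  qed
  then show ?thesis
    unfolding eq c(2) by (simp add: nn_integral_cmult)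
qed

lemma locally_finite_borel_density:
  fixes g :: "'a::euclidean_space \<Rightarrow> real"
  assumes "locally_finite_borel \<nu>" and g: "continuous_on UNIV g"
  shows "locally_finite_borel (density \<nu> (\<lambda>x. ennreal (g x)))"
proof -
  interpret locally_finite_borel \<nu> by fact
  have [measurable]: "g \<in> borel_measurable borel"
    using g by (rule borel_measurable_continuous_onI)
  show ?thesis
  proof
    fix K :: "'a set" assume K: "compact K"
    then have [measurable]: "K \<in> sets borel" by (rule borel_compact)
    have "compact (g ` K)" using K g by (intro compact_continuous_image) (auto intro: continuous_on_subset)
    then obtain B where B: "\<And>x. x \<in> K \<Longrightarrow> g x \<le> B"
      using compact_imp_bounded[of "g ` K"] by (force simp: bounded_iff abs_le_iff)
    have "emeasure (density \<nu> (\<lambda>x. ennreal (g x))) K = (\<integral>\<^sup>+x. ennreal (g x) * indicator K x \<partial>\<nu>)"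
      by (subst emeasure_density) (auto simp: sets_eq)
    also have "\<dots> \<le> (\<integral>\<^sup>+x. ennreal B * indicator K x \<partial>\<nu>)"
      using B by (intro nn_integral_mono) (auto simp: indicator_def intro: ennreal_leI)
    also have "\<dots> < \<infinity>"
      using finite_compact[OF K] by (subst nn_integral_cmult_indicator) (auto simp: sets_eq ennreal_mult_less_top)
    finally show "emeasure (density \<nu> (\<lambda>x. ennreal (g x))) K < \<infinity>" .
  qed (simp add: sets_eq)
qed

text \<open>
  The Prekopa-Leindler inequality applies to \<open>(x, y) \<mapsto> \<theta>(x - y) g(y) H(y)\<close>, where \<open>H\<close> is a
  convolution of \<open>\<nu>\<close> with a tent function and hence log-concave by assumption.  Removing the
  mollification leaves the midpoint inequality for \<open>convolve \<theta> (g \<nu>)\<close>.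
\<close>
lemma log_concave_measure_density:
  fixes \<nu> :: "'a::ordered_euclidean_space measure" and g :: "'a \<Rightarrow> real"
  assumes lf: "locally_finite_borel \<nu>" and lc: "log_concave_measure \<nu>"
    and g: "continuous_on UNIV g" "log_concave_fun g"
  shows "log_concave_measure (density \<nu> (\<lambda>x. ennreal (g x)))"
proof -
  interpret locally_finite_borel \<nu> by fact
  let ?\<mu> = "density \<nu> (\<lambda>x. ennreal (g x))"
  have lf': "locally_finite_borel ?\<mu>" by (rule locally_finite_borel_density[OF lf g(1)])
  interpret D: locally_finite_borel ?\<mu> by fact
  note gnn = log_concave_funD(1)[OF g(2)]
  have [measurable]: "g \<in> borel_measurable borel"
    using g(1) by (rule borel_measurable_continuous_onI)
  obtain c where c: "0 < c" "(\<integral>\<^sup>+u. ennreal (tent 1 (u :: 'a)) \<partial>lborel) = ennreal c"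
    using nn_integral_tent by metis
  define H :: "nat \<Rightarrow> 'a \<Rightarrow> real" where "H n = convolve (tent (real (Suc n))) \<nu>" for n
  have H_lc: "log_concave_fun (H n)" for n
    using lc unfolding log_concave_measure_iff_convolve[OF lf] H_def by (simp add: test_function_tent)
  have H_meas[measurable]: "H n \<in> borel_measurable borel" for n
    unfolding H_def using test_function_tent[of "real (Suc n)"]
    by (intro borel_measurable_continuous_onI continuous_convolve) (auto simp: test_function_def tent_bounds)
  show ?thesis
    unfolding log_concave_measure_iff_convolve[OF lf']
  proof (intro allI impI)
    fix \<theta> :: "'a \<Rightarrow> real" assume "test_function \<theta>"
    then have \<theta>: "continuous_on UNIV \<theta>" "compact (closure {x. \<theta> x \<noteq> 0})" "\<And>x. 0 \<le> \<theta> x"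
      and \<theta>_lc: "log_concave_fun \<theta>"
      by (auto simp: test_function_def log_concave_fun_def)
    have [measurable]: "\<theta> \<in> borel_measurable borel"
      using \<theta>(1) by (rule borel_measurable_continuous_onI)
    let ?u = "convolve \<theta> ?\<mu>"
    have u: "ennreal (?u x) = (\<integral>\<^sup>+y. ennreal (\<theta> (x - y) * g y) \<partial>\<nu>)" for x
      unfolding D.ennreal_convolve[OF \<theta>]
      by (subst nn_integral_density) (auto simp: ennreal_mult \<theta> gnn mult.commute)
    let ?k = "\<lambda>n x. ennreal (real (Suc n) ^ DIM('a)) * (\<integral>\<^sup>+y. ennreal ((\<theta> (x - y) * g y) * H n y) \<partial>lborel)"
    have k_lim: "(\<lambda>n. ?k n x) \<longlonglongrightarrow> ennreal c * ennreal (?u x)" for x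
      unfolding u c(2)[symmetric] H_def
    proof (rule tendsto_mollified_nn_integral)
      show "continuous_on UNIV (\<lambda>y. \<theta> (x - y) * g y)"
        by (intro continuous_intros g(1) continuous_on_compose2[OF \<theta>(1)]) auto
      obtain B R where BR: "0 \<le> B" "0 \<le> R" "\<And>x. \<bar>\<theta> x\<bar> \<le> B" "\<And>x. \<theta> x \<noteq> 0 \<Longrightarrow> norm x \<le> R"
        using continuous_compact_support_bounds[OF \<theta>(1,2)] by metis
      have "{y. \<theta> (x - y) * g y \<noteq> 0} \<subseteq> cball x R"
        using BR(4) by (auto simp: dist_norm)
      then have "bounded {y. \<theta> (x - y) * g y \<noteq> 0}" by (rule bounded_subset[OF bounded_cball])
      then show "compact (closure {y. \<theta> (x - y) * g y \<noteq> 0})" by simp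
    qed (auto intro: mult_nonneg_nonneg \<theta> gnn)
    have k_mid: "?k n x * ?k n y \<le> ?k n ((1/2) *\<^sub>R (x + y)) * ?k n ((1/2) *\<^sub>R (x + y))" for n x y
    proof -
      let ?I = "\<lambda>x. \<integral>\<^sup>+y. ennreal ((\<theta> (x - y) * g y) * H n y) \<partial>lborel"
      note nns = \<theta>(3) gnn log_concave_funD(1)[OF H_lc]
      have "?I x * ?I y \<le> (?I ((1/2) *\<^sub>R (x + y)))\<^sup>2"
      proof (rule prekopa_leindler)
        fix p q :: 'a
        let ?h = "(1/2) *\<^sub>R (p + q)"
        have "(\<theta> (x - p) * g p * H n p) * (\<theta> (y - q) * g q * H n q) =
            (\<theta> (x - p) * \<theta> (y - q)) * (g p * g q) * (H n p * H n q)" by (simp add: ac_simps)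
        also have "\<dots> \<le> (\<theta> ((1/2) *\<^sub>R ((x - p) + (y - q))))\<^sup>2 * (g ?h)\<^sup>2 * (H n ?h)\<^sup>2"
          by (intro mult_mono log_concave_fun_midpoint \<theta>_lc g(2) H_lc) (auto simp: nns)
        also have "(1/2) *\<^sub>R ((x - p) + (y - q)) = (1/2) *\<^sub>R (x + y) - ?h"
          by (simp add: algebra_simps)
        finally have "ennreal ((\<theta> (x - p) * g p * H n p) * (\<theta> (y - q) * g q * H n q)) \<le>
            ennreal ((\<theta> ((1/2) *\<^sub>R (x + y) - ?h) * g ?h * H n ?h)\<^sup>2)"
          by (intro ennreal_leI) (simp add: power_mult_distrib)
        then show "ennreal (\<theta> (x - p) * g p * H n p) * ennreal (\<theta> (y - q) * g q * H n q) \<le>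
            (ennreal (\<theta> ((1/2) *\<^sub>R (x + y) - ?h) * g ?h * H n ?h))\<^sup>2"
          by (simp add: ennreal_mult[symmetric] nns ennreal_power)
      qed measurable
      then have "(ennreal (real (Suc n) ^ DIM('a)))\<^sup>2 * (?I x * ?I y) \<le>
          (ennreal (real (Suc n) ^ DIM('a)))\<^sup>2 * (?I ((1/2) *\<^sub>R (x + y)))\<^sup>2"
        by (rule mult_left_mono) simp
      then show ?thesis by (simp add: power2_eq_square ac_simps)
    qed
    note unn = D.convolve_nonneg[OF \<theta>]
    show "log_concave_fun ?u"
    proof (rule log_concave_fun_of_midpoint[OF D.continuous_convolve[OF \<theta>] unn])
      fix x y :: 'a
      let ?h = "(1/2) *\<^sub>R (x + y)"
      have lim: "(\<lambda>n. ?k n a * ?k n b) \<longlonglongrightarrow> (ennreal c * ennreal (?u a)) * (ennreal c * ennreal (?u b))" for a b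
        by (rule tendsto_mult_ennreal[OF k_lim k_lim]) (auto simp: ennreal_mult_eq_top_iff)
      have "(ennreal c * ennreal (?u x)) * (ennreal c * ennreal (?u y)) \<le>
          (ennreal c * ennreal (?u ?h)) * (ennreal c * ennreal (?u ?h))"
        by (rule LIMSEQ_le[OF lim lim]) (use k_mid in blast)
      then have "ennreal ((c * ?u x) * (c * ?u y)) \<le> ennreal ((c * ?u ?h) * (c * ?u ?h))"
        using c(1) by (simp add: ennreal_mult unn)
      then have "(c * ?u x) * (c * ?u y) \<le> (c * ?u ?h) * (c * ?u ?h)"
        using c(1) unn by (subst (asm) ennreal_le_iff) auto
      then have "c\<^sup>2 * (?u x * ?u y) \<le> c\<^sup>2 * (?u ?h)\<^sup>2"
        by (simp add: power2_eq_square ac_simps)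
      then show "?u x * ?u y \<le> (?u ?h)\<^sup>2"
        using c(1) by simp
    qed
  qed
qed

section \<open>Weak limits\<close>

theorem lemma2:
  fixes \<rho>n :: "nat \<Rightarrow> (real ^ 'd) measure"
    and \<rho> :: "(real ^ 'd) measure"
    and \<alpha> :: "nat \<Rightarrow> real"
  assumes "\<And>n. n \<ge> 1 \<Longrightarrow> radon_measure (\<rho>n n)"
    and "radon_measure \<rho>"
    and "weakly_converges \<rho>n \<rho>"
    and "\<And>n. n \<ge> 1 \<Longrightarrow> 0 \<le> \<alpha> n"
    and "\<And>n. n \<ge> 1 \<Longrightarrow> super_log_concave (\<alpha> n) (\<rho>n n)"
  shows "super_log_concave (INF n\<in>{1..}. \<alpha> n) \<rho>"
proof -
  define a where "a = (INF n\<in>{1..}. \<alpha> n)"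
  define e where "e b = (\<lambda>x :: real ^ 'd. exp (b / 2 * (norm x)\<^sup>2))" for b :: real
  have e_cont: "continuous_on UNIV (e b)" for b
    unfolding e_def by (intro continuous_intros)
  have e_meas[measurable]: "e b \<in> borel_measurable borel" for b
    by (rule borel_measurable_continuous_onI[OF e_cont])
  have e_nn: "0 \<le> e b x" for b x by (simp add: e_def)
  let ?w = "\<lambda>b \<mu>. density \<mu> (\<lambda>x. ennreal (e b x))"
  have lf: "locally_finite_borel \<rho>" "\<And>n. n \<ge> 1 \<Longrightarrow> locally_finite_borel (\<rho>n n)"
    using assms(1,2) by (auto simp: radon_measure_def locally_finite_borel_def)
  have lfw: "locally_finite_borel (?w b \<rho>)" "\<And>n. n \<ge> 1 \<Longrightarrow> locally_finite_borel (?w b (\<rho>n n))" for b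
    using lf by (auto intro: locally_finite_borel_density e_cont)
  have lc: "log_concave_measure (?w a (\<rho>n n))" if n: "n \<ge> 1" for n
  proof -
    interpret locally_finite_borel "\<rho>n n" by (rule lf(2)[OF n])
    have "a \<le> \<alpha> n"
      unfolding a_def using n assms(4) by (intro cINF_lower bdd_belowI2[of _ 0]) auto
    then have g: "log_concave_fun (e (a - \<alpha> n))"
      using log_concave_fun_gaussian[of "(\<alpha> n - a) / 2"] unfolding e_def
      by (simp add: minus_divide_left)
    have "log_concave_measure (?w (\<alpha> n) (\<rho>n n))"
      using assms(5)[OF n] by (simp add: super_log_concave_def e_def)
    then have "log_concave_measure (?w (a - \<alpha> n) (?w (\<alpha> n) (\<rho>n n)))"
      by (rule log_concave_measure_density[OF lfw(2)[OF n] _ e_cont g])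
    also have "?w (a - \<alpha> n) (?w (\<alpha> n) (\<rho>n n)) = density (\<rho>n n) (\<lambda>x. ennreal (e (\<alpha> n) x) * ennreal (e (a - \<alpha> n) x))"
      by (intro density_density_eq) measurable
    also have "(\<lambda>x. ennreal (e (\<alpha> n) x) * ennreal (e (a - \<alpha> n) x)) = (\<lambda>x. ennreal (e a x))"
      by (rule ext) (simp add: e_def ennreal_mult[symmetric] exp_add[symmetric] field_simps)
    finally show ?thesis .
  qed
  have "log_concave_measure (?w a \<rho>)"
    unfolding log_concave_measure_iff_convolve[OF lfw(1)]
  proof (intro allI impI)
    fix \<theta> :: "real ^ 'd \<Rightarrow> real" assume tf: "test_function \<theta>"
    then have \<theta>: "continuous_on UNIV \<theta>" "compact (closure {x. \<theta> x \<noteq> 0})" "\<And>x. 0 \<le> \<theta> x"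
      by (auto simp: test_function_def log_concave_fun_def)
    have [measurable]: "\<theta> \<in> borel_measurable borel"
      using \<theta>(1) by (rule borel_measurable_continuous_onI)
    have conv: "ennreal (convolve \<theta> (?w a \<mu>) x) = (\<integral>\<^sup>+y. ennreal (\<theta> (x - y) * e a y) \<partial>\<mu>)"
      if "locally_finite_borel \<mu>" "locally_finite_borel (?w a \<mu>)" for \<mu> x
    proof -
      interpret locally_finite_borel \<mu> by fact
      show ?thesis
        unfolding locally_finite_borel.ennreal_convolve[OF that(2) \<theta>]
        by (subst nn_integral_density) (auto simp: ennreal_mult' \<theta> e_nn mult.commute)
    qed
    have lim: "(\<lambda>n. convolve \<theta> (?w a (\<rho>n n)) x) \<longlonglongrightarrow> convolve \<theta> (?w a \<rho>) x" for x
    proof -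
      let ?f = "\<lambda>y. \<theta> (x - y) * e a y"
      have cf: "continuous_on UNIV ?f"
        by (intro continuous_intros e_cont continuous_on_compose2[OF \<theta>(1)]) auto
      obtain B R where BR: "0 \<le> B" "0 \<le> R" "\<And>x. \<bar>\<theta> x\<bar> \<le> B" "\<And>x. \<theta> x \<noteq> 0 \<Longrightarrow> norm x \<le> R"
        using continuous_compact_support_bounds[OF \<theta>(1,2)] by metis
      \<comment> \<open>The growing weight is harmless: \<open>?f\<close> vanishes outside a ball.\<close>
      have "range ?f \<subseteq> insert 0 (?f ` cball x R)"
        using BR(4) by (force simp: dist_norm)
      moreover have "bounded (?f ` cball x R)"
        by (intro compact_imp_bounded compact_continuous_image continuous_on_subset[OF cf]) auto
      ultimately have "bounded (range ?f)" by (meson bounded_insert bounded_subset)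
      then have "(\<lambda>n. \<integral>\<^sup>+y. ennreal (?f y) \<partial>\<rho>n n) \<longlonglongrightarrow> (\<integral>\<^sup>+y. ennreal (?f y) \<partial>\<rho>)"
        using assms(3) cf \<theta>(3) e_nn unfolding weakly_converges_def by simp
      then have "(\<lambda>n. \<integral>\<^sup>+y. ennreal (?f y) \<partial>\<rho>n n) \<longlonglongrightarrow> ennreal (convolve \<theta> (?w a \<rho>) x)"
        by (simp add: conv[OF lf(1) lfw(1)])
      then have "(\<lambda>n. ennreal (convolve \<theta> (?w a (\<rho>n n)) x)) \<longlonglongrightarrow> ennreal (convolve \<theta> (?w a \<rho>) x)"
        by (rule Lim_transform_eventually)
          (auto intro!: eventually_sequentiallyI[of 1] simp: conv[OF lf(2) lfw(2)])
      then show ?thesis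
        by (subst (asm) tendsto_ennreal_iff)
          (auto intro!: eventually_sequentiallyI[of 1] locally_finite_borel.convolve_nonneg[OF lfw(2) \<theta>]
            locally_finite_borel.convolve_nonneg[OF lfw(1) \<theta>])
    qed
    show "log_concave_fun (convolve \<theta> (?w a \<rho>))"
    proof (rule log_concave_fun_limit[OF _ lim])
      show "log_concave_fun (convolve \<theta> (?w a (\<rho>n n)))" if "n \<ge> 1" for n
        using lc[OF that] tf unfolding log_concave_measure_iff_convolve[OF lfw(2)[OF that]] by blast
    qed
  qed
  then show ?thesis by (simp add: super_log_concave_def a_def e_def)
qed

end
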